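(* Let $m\ge3$ be odd, $n,p,q\ge2$ even, and $k\ge3$. Suppose $\mathcal{F}_i$, $\mathcal{G}_i$, $\mathcal{H}_i$, $\mathcal{K}_i$ ($1\le i\le k$) are families of pairwise almost orthogonal symmetric chain decompositions of $Q_m$, $Q_n$, $Q_p$, $Q_q$ respectively, with the families for $Q_n$, $Q_p$ and $Q_q$ good. Then there exist $k$ pairwise almost orthogonal symmetric chain decompositions $\mathcal{D}_1,\dots,\mathcal{D}_k$ of $Q_{m+n+p+q}=Q_m\times Q_n\times Q_p\times Q_q$ such that for each $i$ every chain of $\mathcal{D}_i$ is contained in a cuboid $A\times B\times C\times D$ with $A\in\mathcal{F}_i$, $B\in\mathcal{G}_i$, $C\in\mathcal{H}_i$, $D\in\mathcal{K}_i$.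
   Context: $Q_n$ denotes the Boolean lattice of subsets of $[n]=\{1,\dots,n\}$ under inclusion; products of hypercubes (product order) are identified with the hypercube of the summed dimension. A symmetric chain in $Q_n$ consists of exactly one subset of each size $j,\dots,n-j$ for some $j$; a symmetric chain decomposition (SCD) is a partition into symmetric chains. Two SCDs $\mathcal{F},\mathcal{G}$ of $Q_n$ are almost orthogonal if for all chains $A\in\mathcal{F}$, $B\in\mathcal{G}$, $|A\cap B|\le1$, except when $A$ and $B$ both contain $\varnothing$ and $[n]$, in which case $|A\cap B|=2$. For $n$ even, a collection $\{\mathcal{F}^j\}$ of pairwise almost orthogonal SCDs of $Q_n$ is good if the $1$-element chains occurring in the different $\mathcal{F}^j$ are pairwise distinct. *)

theory Defs
  imports Main "HOL-Library.Disjoint_Sets"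
begin

abbreviation hypercube :: "nat \<Rightarrow> nat set set" where
  "hypercube n \<equiv> Pow {1..n}"

text \<open>
  A chain under inclusion with exactly one member of each size \<open>j, \<dots>, n - j\<close> and no others.
  The condition \<open>2 * j \<le> n\<close> keeps the subtraction honest and the interval nonempty.
\<close>
definition symmetric_chain :: "nat \<Rightarrow> nat set set \<Rightarrow> bool" where
  "symmetric_chain n C \<longleftrightarrow>
     C \<subseteq> hypercube n \<and> (\<forall>X\<in>C. \<forall>Y\<in>C. X \<subseteq> Y \<or> Y \<subseteq> X) \<and>
     (\<exists>j. 2 * j \<le> n \<and> bij_betw card C {j..n - j})"

definition scd :: "nat \<Rightarrow> nat set set set \<Rightarrow> bool" where
  "scd n \<F> \<longleftrightarrow> partition_on (hypercube n) \<F> \<and> (\<forall>C\<in>\<F>. symmetric_chain n C)"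

definition almost_orthogonal :: "nat \<Rightarrow> nat set set set \<Rightarrow> nat set set set \<Rightarrow> bool" where
  "almost_orthogonal n \<F> \<G> \<longleftrightarrow>
     (\<forall>A\<in>\<F>. \<forall>B\<in>\<G>.
        if {{}, {1..n}} \<subseteq> A \<and> {{}, {1..n}} \<subseteq> B then card (A \<inter> B) = 2
        else card (A \<inter> B) \<le> 1)"

definition almost_orthogonal_scds ::
    "nat \<Rightarrow> 'i set \<Rightarrow> ('i \<Rightarrow> nat set set set) \<Rightarrow> bool" where
  "almost_orthogonal_scds n I \<F> \<longleftrightarrow>
     (\<forall>i\<in>I. scd n (\<F> i)) \<and>
     (\<forall>i\<in>I. \<forall>j\<in>I. i \<noteq> j \<longrightarrow> almost_orthogonal n (\<F> i) (\<F> j))"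

definition good_scds :: "nat \<Rightarrow> 'i set \<Rightarrow> ('i \<Rightarrow> nat set set set) \<Rightarrow> bool" where
  "good_scds n I \<F> \<longleftrightarrow>
     almost_orthogonal_scds n I \<F> \<and>
     disjoint_family_on (\<lambda>i. {C \<in> \<F> i. card C = 1}) I"

text \<open>
  The identification of \<open>Q\<^sub>m \<times> Q\<^sub>n\<close> with \<open>Q\<^sub>m\<^sub>+\<^sub>n\<close>: the second factor lives on the
  coordinates \<open>m + 1, \<dots>, m + n\<close>.
\<close>
definition cube_pair :: "nat \<Rightarrow> nat set \<Rightarrow> nat set \<Rightarrow> nat set" where
  "cube_pair m x y = x \<union> (\<lambda>i. m + i) ` y"

text \<open>\<open>A \<times> B \<times> C \<times> D\<close> as a subset of \<open>Q\<^sub>m \<times> Q\<^sub>n \<times> Q\<^sub>p \<times> Q\<^sub>q\<close>, identified with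
  a single hypercube; the last dimension is not needed for the shifts.\<close>
definition cuboid ::
    "nat \<Rightarrow> nat \<Rightarrow> nat \<Rightarrow> nat set set \<Rightarrow> nat set set \<Rightarrow> nat set set \<Rightarrow> nat set set \<Rightarrow> nat set set" where
  "cuboid m n p A B C D =
     {cube_pair m a (cube_pair n b (cube_pair p c d)) | a b c d.
        a \<in> A \<and> b \<in> B \<and> c \<in> C \<and> d \<in> D}"

lemma cube_pair_subset_iff:
  assumes "x \<in> hypercube m" "x' \<in> hypercube m" "y \<in> hypercube n" "y' \<in> hypercube n"
  shows "cube_pair m x y \<subseteq> cube_pair m x' y' \<longleftrightarrow> x \<subseteq> x' \<and> y \<subseteq> y'"
proof
  assume L: "cube_pair m x y \<subseteq> cube_pair m x' y'"
  have "i \<in> x'" if "i \<in> x" for i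
  proof -
    have "i \<in> cube_pair m x' y'" "i \<le> m" "\<forall>k\<in>y'. 1 \<le> k"
      using L that assms by (auto simp: cube_pair_def)
    then show ?thesis by (force simp: cube_pair_def)
  qed
  moreover have "i \<in> y'" if "i \<in> y" for i
  proof -
    have "m + i \<in> cube_pair m x' y'" "1 \<le> i" "\<forall>k\<in>x'. k \<le> m"
      using L that assms by (auto simp: cube_pair_def)
    then show ?thesis by (force simp: cube_pair_def)
  qed
  ultimately show "x \<subseteq> x' \<and> y \<subseteq> y'" by blast
qed (auto simp: cube_pair_def)

lemma bij_betw_cube_pair:
  "bij_betw (\<lambda>(x, y). cube_pair m x y) (hypercube m \<times> hypercube n) (hypercube (m + n))"
  unfolding bij_betw_def
proof
  show "inj_on (\<lambda>(x, y). cube_pair m x y) (hypercube m \<times> hypercube n)"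
  proof (rule inj_onI, clarify)
    fix x y x' y'
    assume mem: "x \<subseteq> {1..m}" "y \<subseteq> {1..n}" "x' \<subseteq> {1..m}" "y' \<subseteq> {1..n}"
      and eq: "cube_pair m x y = cube_pair m x' y'"
    have "x \<subseteq> x' \<and> y \<subseteq> y'" "x' \<subseteq> x \<and> y' \<subseteq> y"
      using cube_pair_subset_iff[of x m x' y n y'] cube_pair_subset_iff[of x' m x y' n y] mem eq
      by auto
    then show "x = x' \<and> y = y'" by blast
  qed
  show "(\<lambda>(x, y). cube_pair m x y) ` (hypercube m \<times> hypercube n) = hypercube (m + n)"
  proof (intro equalityI subsetI)
    fix z assume z: "z \<in> hypercube (m + n)"
    define x where "x = z \<inter> {1..m}"
    define y where "y = {i \<in> {1..n}. m + i \<in> z}"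
    have "i \<in> cube_pair m x y" if "i \<in> z" for i
    proof (cases "i \<le> m")
      case True
      then show ?thesis using that z by (auto simp: cube_pair_def x_def)
    next
      case False
      then have "i - m \<in> y" "i = m + (i - m)" using that z by (auto simp: y_def)
      then show ?thesis unfolding cube_pair_def by blast
    qed
    then have "z \<subseteq> cube_pair m x y" by blast
    moreover have "cube_pair m x y \<subseteq> z" by (auto simp: cube_pair_def x_def y_def)
    ultimately have "z = cube_pair m x y" by blast
    moreover have "x \<in> hypercube m" "y \<in> hypercube n" by (auto simp: x_def y_def)
    ultimately show "z \<in> (\<lambda>(x, y). cube_pair m x y) ` (hypercube m \<times> hypercube n)" by auto
  qed (fastforce simp: cube_pair_def)
qed

end

theory Submission
  imports Defs
begin

text \<open>
  Each cuboid \<open>A \<times> B \<times> C \<times> D\<close> is decomposed into symmetric chains on its own. If two chains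
  from \<open>\<D>\<^sub>i\<close> and \<open>\<D>\<^sub>j\<close> share \<open>u \<subset> v\<close>, then by almost orthogonality of the factors each of the four
  coordinates of \<open>u\<close> and \<open>v\<close> is either equal or runs from bottom to top, and in the latter case the
  factor chain is a full one on both sides. Hence it suffices to decompose every cuboid so that
  no chain contains a pair that differs exactly in a nonempty proper set of ``flagged'' full factors. With three
  families, full chains have at least five elements, which leaves room for such decompositions.

  A cuboid with a one-element factor cannot avoid all of these pairs, but by goodness the
  corresponding factor of the other cuboid then has at least three elements, so that the forbidden
  pairs can be shared out between the two cuboids; this is the choice of flags.

  Products are built two factors at a time. In a grid of two chains the outer two hooks are
  modified so that they avoid the pairs that run along one side of the grid; the remaining rectangle
  contains no such pair at all. Only the product of a two-element chain with three full chains needs a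
  finer rearrangement of three hooks.
\<close>

section \<open>Chains and linked pairs\<close>

text \<open>The obstacle is chain length. \<open>join_dec\<close> may return one-element chains, and
  neither a one-element nor a two-element chain can be joined with a partner that contains the empty
  set and its ground set as a linked pair: a long product chain would then repeat this pair with the
  other coordinate fixed. So three such factors cannot simply be joined one after another. Products
  of long factors are instead kept as the explicit pieces of the corner construction, namely two
  long chains and a rectangle. The rectangle loses two members on each side; five minus two is
  three, the least length that such a partner tolerates. The five in turn comes from
  \<open>k \<ge> 3\<close>: blocks of size 2 admit no three good families and blocks of size 3 no
  three almost orthogonal ones, so by parity every block has at least four elements and a full chain
  at least five members.\<close>

definition rank_chain :: "nat \<Rightarrow> 'a set set \<Rightarrow> bool" where
  "rank_chain N X \<longleftrightarrow> (\<forall>u\<in>X. \<forall>v\<in>X. u \<subseteq> v \<or> v \<subseteq> u) \<and>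
     (\<exists>l h. l \<le> h \<and> l + h = N \<and> bij_betw card X {l..h})"

definition rank_enum :: "(nat \<Rightarrow> 'a set) \<Rightarrow> nat \<Rightarrow> nat \<Rightarrow> bool" where
  "rank_enum x l s \<longleftrightarrow> s \<ge> 1 \<and> (\<forall>i<s. finite (x i) \<and> card (x i) = l + i) \<and>
     (\<forall>i j. i \<le> j \<longrightarrow> j < s \<longrightarrow> x i \<subseteq> x j)"

lemma rank_chain_enum:
  assumes X: "rank_chain N X" and fin: "\<And>u. u \<in> X \<Longrightarrow> finite u"
  obtains x l s where "rank_enum x l s" "X = x ` {..<s}" "card X = s" "2 * l + s = N + 1"
proof -
  obtain l h where lh: "l \<le> h" "l + h = N" "bij_betw card X {l..h}"
    using X unfolding rank_chain_def by auto
  define x where "x i = inv_into X card (l + i)" for i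
  define s where "s = h + 1 - l"
  have mem: "x i \<in> X" "card (x i) = l + i" if "i < s" for i
  proof -
    have "l + i \<in> card ` X"
      using that lh unfolding s_def bij_betw_def by auto
    then show "x i \<in> X" "card (x i) = l + i"
      unfolding x_def by (auto intro: inv_into_into f_inv_into_f)
  qed
  have "X \<subseteq> x ` {..<s}"
  proof
    fix u assume u: "u \<in> X"
    have r: "card u \<in> {l..h}" using u lh(3) by (auto simp: bij_betw_def)
    then have "card u - l < s" "l + (card u - l) = card u" by (auto simp: s_def)
    then have "u = x (card u - l)"
      using mem[of "card u - l"] u lh(3) unfolding bij_betw_def inj_on_def by metis
    then show "u \<in> x ` {..<s}" using \<open>card u - l < s\<close> by blast
  qed
  then have "X = x ` {..<s}" using mem by auto
  moreover have "card X = s" using bij_betw_same_card[OF lh(3)] by (simp add: s_def)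
  moreover have "x i \<subseteq> x j" if "i \<le> j" "j < s" for i j
  proof (cases "i = j")
    case False
    have "x i \<subseteq> x j \<or> x j \<subseteq> x i" using X mem that unfolding rank_chain_def by auto
    moreover have "\<not> x j \<subseteq> x i"
      using mem[of i] mem[of j] that False card_mono[OF fin, of "x i" "x j"] by auto
    ultimately show ?thesis by blast
  qed auto
  then have "rank_enum x l s"
    using mem fin lh unfolding rank_enum_def s_def by auto
  moreover have "2 * l + s = N + 1" using lh by (auto simp: s_def)
  ultimately show thesis using that by blast
qed

text \<open>\<open>F\<close> is a set of pairwise disjoint blocks; \<open>v\<close> arises from \<open>u\<close> by switching some blocks from empty to full.\<close>

definition link :: "'a set set \<Rightarrow> 'a set \<Rightarrow> 'a set \<Rightarrow> bool" where
  "link F u v \<longleftrightarrow> (\<exists>S\<subseteq>F. u \<inter> \<Union>S = {} \<and> v = u \<union> \<Union>S)"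

text \<open>These are the conditions under which the empty set and \<open>I\<close> form a link
  inside \<open>P\<close>. They are imposed on whole families as well as on chains, so that a
  product can be tested before it is decomposed.\<close>

definition spans :: "'a set set \<Rightarrow> 'a set \<Rightarrow> 'a set set \<Rightarrow> bool" where
  "spans F I P \<longleftrightarrow> {} \<in> P \<and> I \<in> P \<and> (\<exists>S\<subseteq>F. \<Union>S = I)"

text \<open>The bound 2 forces every spanning chain through at least three ranks, which
  \<open>spans_card\<close> exploits.\<close>

definition splits :: "'a set set \<Rightarrow> 'a set \<Rightarrow> bool" where
  "splits F I \<longleftrightarrow> finite I \<and> card I \<ge> 2 \<and> (\<forall>K\<in>F. K \<subseteq> I \<or> K \<inter> I = {})"

text \<open>The exempted pair mirrors the exception in almost orthogonality. \<open>N\<close> is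
  independent of \<open>card I\<close> because trimmed chains stay on the ground set
  \<open>I\<close> but are symmetric about another rank; in a product only the sum of the two values
  counts.\<close>

definition linkless_chain :: "'a set set \<Rightarrow> 'a set \<Rightarrow> nat \<Rightarrow> nat \<Rightarrow> 'a set set \<Rightarrow> bool" where
  "linkless_chain F I N k X \<longleftrightarrow> X \<subseteq> Pow I \<and> rank_chain N X \<and> k \<le> card X \<and>
     (\<forall>u\<in>X. \<forall>v\<in>X. link F u v \<longrightarrow> u \<noteq> v \<longrightarrow> u = {} \<and> v = I)"

definition linkless_dec :: "'a set set \<Rightarrow> 'a set \<Rightarrow> nat \<Rightarrow> nat \<Rightarrow> 'a set set \<Rightarrow> bool" where
  "linkless_dec F I N k P \<longleftrightarrow> (\<exists>\<D>. partition_on P \<D> \<and> (\<forall>X\<in>\<D>. linkless_chain F I N k X))"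

text \<open>For families over disjoint ground sets, the product of posets; unlike \<open>\<times>\<close> it is
  commutative and associative on the nose.\<close>

definition join :: "'a set set \<Rightarrow> 'a set set \<Rightarrow> 'a set set" (infixl "\<otimes>" 70) where
  "P \<otimes> Q = (\<Union>u\<in>P. \<Union>v\<in>Q. {u \<union> v})"

lemma join_iff: "w \<in> P \<otimes> Q \<longleftrightarrow> (\<exists>u\<in>P. \<exists>v\<in>Q. w = u \<union> v)"
  by (auto simp: join_def)

lemma join_commute: "P \<otimes> Q = Q \<otimes> P"
proof -
  have "P \<otimes> Q = (\<Union>v\<in>Q. \<Union>u\<in>P. {u \<union> v})" unfolding join_def by auto
  then show ?thesis unfolding join_def by (simp only: Un_commute)
qed

lemma join_assoc: "P \<otimes> Q \<otimes> R = P \<otimes> (Q \<otimes> R)"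
  unfolding join_def by (simp add: Un_assoc)

lemma join_left_commute: "P \<otimes> (Q \<otimes> R) = Q \<otimes> (P \<otimes> R)"
  using join_commute[of P Q] join_assoc[of P Q R] join_assoc[of Q P R] by simp

lemmas join_ac = join_assoc join_commute join_left_commute

lemma join_Un: "(P \<union> Q) \<otimes> R = P \<otimes> R \<union> Q \<otimes> R"
  unfolding join_def by (rule UN_Un)

lemma join_subset_Pow: "P \<subseteq> Pow I \<Longrightarrow> Q \<subseteq> Pow J \<Longrightarrow> P \<otimes> Q \<subseteq> Pow (I \<union> J)"
  unfolding join_def by auto

lemma join_unique:
  assumes "I \<inter> J = {}" "u \<subseteq> I" "u' \<subseteq> I" "v \<subseteq> J" "v' \<subseteq> J" "u \<union> v = u' \<union> v'"
  shows "u = u' \<and> v = v'"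
  using assms by blast

lemma join_disjoint:
  assumes "I \<inter> J = {}" "P \<subseteq> Pow I" "P' \<subseteq> Pow I" "Q \<subseteq> Pow J" "Q' \<subseteq> Pow J" "P \<inter> P' = {}"
  shows "(P \<otimes> Q) \<inter> (P' \<otimes> Q') = {}"
proof (rule ccontr)
  assume "(P \<otimes> Q) \<inter> (P' \<otimes> Q') \<noteq> {}"
  then obtain u v u' v' where "u \<in> P" "v \<in> Q" "u' \<in> P'" "v' \<in> Q'" "u \<union> v = u' \<union> v'"
    by (auto simp: join_iff)
  moreover from this have "u \<subseteq> I" "u' \<subseteq> I" "v \<subseteq> J" "v' \<subseteq> J" using assms(2-5) by auto
  ultimately have "u = u'" using join_unique[OF assms(1), of u u' v v'] by simp
  then show False using \<open>u \<in> P\<close> \<open>u' \<in> P'\<close> assms(6) by blast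
qed

section \<open>Decompositions into linkless chains\<close>

lemma linkless_dec_mono: "linkless_dec F I N k P \<Longrightarrow> k' \<le> k \<Longrightarrow> linkless_dec F I N k' P"
  unfolding linkless_dec_def linkless_chain_def by (meson le_trans)

lemma linkless_dec_single:
  assumes "linkless_chain F I N k X" shows "linkless_dec F I N k X"
proof -
  have "X \<noteq> {}"
    using assms unfolding linkless_chain_def rank_chain_def by (auto simp: bij_betw_def)
  then have "partition_on X {X}" by (auto simp: partition_on_def disjoint_def)
  then show ?thesis using assms unfolding linkless_dec_def by blast
qed

lemma linkless_dec_subset: "linkless_dec F I N k P \<Longrightarrow> P \<subseteq> Pow I"
  unfolding linkless_dec_def linkless_chain_def partition_on_def by blast

lemma partition_on_UN:
  assumes dis: "\<And>P Q. P \<in> \<P> \<Longrightarrow> Q \<in> \<P> \<Longrightarrow> P \<noteq> Q \<Longrightarrow> P \<inter> Q = {}"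
    and part: "\<And>P. P \<in> \<P> \<Longrightarrow> partition_on P (D P)"
  shows "partition_on (\<Union>\<P>) (\<Union>P\<in>\<P>. D P)"
proof (rule partition_onI)
  have "\<Union>(\<Union>P\<in>\<P>. D P) = (\<Union>P\<in>\<P>. \<Union>(D P))" by auto
  also have "\<dots> = \<Union>\<P>" using part unfolding partition_on_def by simp
  finally show "\<Union>(\<Union>P\<in>\<P>. D P) = \<Union>\<P>" .
next
  fix X Y assume "X \<in> (\<Union>P\<in>\<P>. D P)" "Y \<in> (\<Union>P\<in>\<P>. D P)" "X \<noteq> Y"
  then obtain P Q where PQ: "P \<in> \<P>" "Q \<in> \<P>" "X \<in> D P" "Y \<in> D Q" by auto
  then have sub: "X \<subseteq> P" "Y \<subseteq> Q" using part unfolding partition_on_def by auto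
  show "disjnt X Y"
  proof (cases "P = Q")
    case True
    then show ?thesis using part[OF PQ(1)] PQ \<open>X \<noteq> Y\<close>
      unfolding partition_on_def disjoint_def disjnt_def by blast
  next
    case False
    then show ?thesis using dis[OF PQ(1,2)] sub unfolding disjnt_def by blast
  qed
next
  show "{} \<notin> (\<Union>P\<in>\<P>. D P)" using part unfolding partition_on_def by auto
qed

lemma linkless_dec_Union:
  assumes dis: "\<And>P Q. P \<in> \<P> \<Longrightarrow> Q \<in> \<P> \<Longrightarrow> P \<noteq> Q \<Longrightarrow> P \<inter> Q = {}"
    and dec: "\<And>P. P \<in> \<P> \<Longrightarrow> linkless_dec F I N k P"
  shows "linkless_dec F I N k (\<Union>\<P>)"
proof -
  obtain D where D: "\<And>P. P \<in> \<P> \<Longrightarrow> partition_on P (D P)"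
      "\<And>P X. P \<in> \<P> \<Longrightarrow> X \<in> D P \<Longrightarrow> linkless_chain F I N k X"
    using dec unfolding linkless_dec_def by metis
  have "partition_on (\<Union>\<P>) (\<Union>P\<in>\<P>. D P)" by (rule partition_on_UN[OF dis D(1)])
  then show ?thesis using D(2) unfolding linkless_dec_def by blast
qed

lemma linkless_dec_Un:
  assumes "linkless_dec F I N k P" "linkless_dec F I N k Q" "P \<inter> Q = {}"
  shows "linkless_dec F I N k (P \<union> Q)"
  using linkless_dec_Union[of "{P, Q}" F I N k] assms by auto

section \<open>Links and spanning families under products\<close>

lemma link_restrict:
  assumes "splits F I" "link F u v"
  shows "link F (u \<inter> I) (v \<inter> I)"
proof -
  obtain S where S: "S \<subseteq> F" "u \<inter> \<Union>S = {}" "v = u \<union> \<Union>S"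
    using assms(2) unfolding link_def by auto
  define S1 where "S1 = {K\<in>S. K \<subseteq> I}"
  have "K \<subseteq> I \<or> K \<inter> I = {}" if "K \<in> S" for K
    using assms(1) S(1) that unfolding splits_def by auto
  \<comment> \<open>No block of \<open>S\<close> straddles the boundary of \<open>I\<close>, so
    intersecting with \<open>I\<close> merely drops the blocks outside.\<close>
  then have e: "\<Union>S \<inter> I = \<Union>S1" unfolding S1_def by fastforce
  have "v \<inter> I = u \<inter> I \<union> \<Union>S1" unfolding S(3) e[symmetric] by (rule Int_Un_distrib2)
  moreover have "u \<inter> I \<inter> \<Union>S1 = {}" unfolding e[symmetric] using S(2) by auto
  moreover have "S1 \<subseteq> F" using S(1) by (auto simp: S1_def)
  ultimately show ?thesis unfolding link_def by blast
qed

lemma link_join: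
  assumes "splits F I" "splits F J" "I \<inter> J = {}" "link F (u \<union> v) (u' \<union> v')"
    and "u \<subseteq> I" "u' \<subseteq> I" "v \<subseteq> J" "v' \<subseteq> J"
  shows "link F u u'" "link F v v'"
proof -
  have e: "(w \<union> z) \<inter> I = w" "(w \<union> z) \<inter> J = z" if "w \<subseteq> I" "z \<subseteq> J" for w z
    using that assms(3) by auto
  show "link F u u'" "link F v v'"
    using link_restrict[OF assms(1,4)] link_restrict[OF assms(2,4)] assms(5-8) by (simp_all add: e)
qed

lemma link_ground: "link F {} I \<Longrightarrow> \<exists>S\<subseteq>F. \<Union>S = I"
  unfolding link_def by auto

lemma splits_Un: 
  assumes "splits F I" "splits F J" "I \<inter> J = {}" shows "splits F (I \<union> J)"
proof -
  have "card I \<le> card (I \<union> J)" using assms by (intro card_mono) (auto simp: splits_def)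
  moreover have "K \<subseteq> I \<union> J \<or> K \<inter> (I \<union> J) = {}" if "K \<in> F" for K
  proof -
    have "K \<subseteq> I \<or> K \<inter> I = {}" "K \<subseteq> J \<or> K \<inter> J = {}" using assms that unfolding splits_def by auto
    then show ?thesis by auto
  qed
  ultimately show ?thesis using assms unfolding splits_def by auto
qed

text \<open>A link from the empty set to the whole ground set restricts to one on each factor. Used
  contrapositively: one non-spanning factor makes the product non-spanning, however it is decomposed
  later.\<close>

lemma spans_join:
  assumes "splits F I" "splits F J" "I \<inter> J = {}" "P \<subseteq> Pow I" "Q \<subseteq> Pow J"
    and "spans F (I \<union> J) (P \<otimes> Q)"
  shows "spans F I P" "spans F J Q"
proof -
  obtain S where S: "S \<subseteq> F" "\<Union>S = I \<union> J" using assms(6) unfolding spans_def by auto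
  have l: "link F ({} \<union> {}) (I \<union> J)" unfolding link_def using S by (intro exI[of _ S]) simp
  have "link F {} I" "link F {} J"
    using link_join[OF assms(1-3) l] by auto
  moreover have "{} \<in> P" "{} \<in> Q" using assms(6) by (auto simp: spans_def join_iff)
  moreover have "I \<in> P \<and> J \<in> Q"
  proof -
    obtain u v where "u \<in> P" "v \<in> Q" "I \<union> J = u \<union> v"
      using assms(6) unfolding spans_def join_iff by auto
    moreover from this have "u \<subseteq> I" "v \<subseteq> J" using assms(4,5) by auto
    ultimately show ?thesis using join_unique[OF assms(3), of I u J v] by simp
  qed
  ultimately show "spans F I P" "spans F J Q" unfolding spans_def by (auto dest: link_ground)
qed

section \<open>Products of two factors\<close>

text \<open>Symmetric chains of an \<open>s \<times> t\<close> grid, whose ranks run from \<open>0\<close> to \<open>s + t - 2\<close>.\<close>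

definition grid_chain :: "nat \<Rightarrow> nat \<Rightarrow> (nat \<times> nat) set \<Rightarrow> bool" where
  "grid_chain s t Z \<longleftrightarrow> Z \<subseteq> {..<s} \<times> {..<t} \<and>
     (\<forall>(i, j)\<in>Z. \<forall>(i', j')\<in>Z. i \<le> i' \<and> j \<le> j' \<or> i' \<le> i \<and> j' \<le> j) \<and>
     (\<exists>a b. a \<le> b \<and> a + b + 2 = s + t \<and> (\<lambda>(i, j). i + j) ` Z = {a..b})"

abbreviation grid_set :: "(nat \<Rightarrow> 'a set) \<Rightarrow> (nat \<Rightarrow> 'a set) \<Rightarrow> (nat \<times> nat) set \<Rightarrow> 'a set set" where
  "grid_set x y Z \<equiv> (\<lambda>(i, j). x i \<union> y j) ` Z"

lemma rank_enum_inj: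
  assumes "rank_enum x l s" "i < s" "j < s" "x i = x j" shows "i = j"
  using assms unfolding rank_enum_def by (metis add_left_cancel)

text \<open>Cardinalities add over disjoint ground sets, so the grid rank \<open>i + j\<close> is
  shifted by \<open>l + l'\<close>. The two equations for \<open>N\<close> and \<open>N'\<close>
  turn symmetry about the middle of the grid into lowest plus highest rank equal to
  \<open>N + N'\<close>.\<close>

lemma rank_chain_grid:
  assumes x: "rank_enum x l s" and y: "rank_enum y l' t" and IJ: "I \<inter> J = {}"
    and sub: "x ` {..<s} \<subseteq> Pow I" "y ` {..<t} \<subseteq> Pow J" and Z: "grid_chain s t Z"
    and N: "2 * l + s = N + 1" "2 * l' + t = N' + 1"
  shows "rank_chain (N + N') (grid_set x y Z)" "card (grid_set x y Z) = card Z"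
proof -
  obtain a b where ab: "a \<le> b" "a + b + 2 = s + t" "(\<lambda>(i, j). i + j) ` Z = {a..b}"
    using Z unfolding grid_chain_def by auto
  have cd: "card (x i \<union> y j) = l + l' + (i + j)" if "(i, j) \<in> Z" for i j
  proof -
    have "i < s" "j < t" using Z that unfolding grid_chain_def by auto
    then have "x i \<subseteq> I" "y j \<subseteq> J" "finite (x i)" "finite (y j)" "card (x i) = l + i" "card (y j) = l' + j"
      using x y sub unfolding rank_enum_def by auto
    moreover have "x i \<inter> y j = {}" using calculation IJ by blast
    ultimately show ?thesis by (simp add: card_Un_disjoint)
  qed
  have inj: "i = i' \<and> j = j'" if "(i, j) \<in> Z" "(i', j') \<in> Z" "i + j = i' + j'" for i j i' j'
  proof -
    have "i \<le> i' \<and> j \<le> j' \<or> i' \<le> i \<and> j' \<le> j"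
      using Z that unfolding grid_chain_def by fast
    then show ?thesis using that(3) by auto
  qed
  have "card ` grid_set x y Z = (\<lambda>n. l + l' + n) ` (\<lambda>(i, j). i + j) ` Z"
    unfolding image_image using cd by (intro image_cong) auto
  also have "\<dots> = {l + l' + a..l + l' + b}" unfolding ab(3) by simp
  finally have img: "card ` grid_set x y Z = {l + l' + a..l + l' + b}" .
  have "inj_on card (grid_set x y Z)"
  proof (rule inj_onI)
    fix u v assume "u \<in> grid_set x y Z" "v \<in> grid_set x y Z" "card u = card v"
    then obtain i j i' j' where p: "u = x i \<union> y j" "v = x i' \<union> y j'" "(i, j) \<in> Z" "(i', j') \<in> Z"
      by auto
    then have "i + j = i' + j'" using cd[of i j] cd[of i' j'] \<open>card u = card v\<close> by simp
    then show "u = v" using inj p by metis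
  qed
  with img have "bij_betw card (grid_set x y Z) {l + l' + a..l + l' + b}" by (simp add: bij_betw_def)
  moreover have "l + l' + a + (l + l' + b) = N + N'" using ab N by simp
  moreover have "u \<subseteq> v \<or> v \<subseteq> u" if "u \<in> grid_set x y Z" "v \<in> grid_set x y Z" for u v
  proof -
    obtain i j i' j' where p: "u = x i \<union> y j" "v = x i' \<union> y j'" "(i, j) \<in> Z" "(i', j') \<in> Z"
      using \<open>u \<in> _\<close> \<open>v \<in> _\<close> by auto
    then have le: "i \<le> i' \<and> j \<le> j' \<or> i' \<le> i \<and> j' \<le> j"
      using Z unfolding grid_chain_def by fast
    have lt: "i < s" "i' < s" "j < t" "j' < t" using p Z unfolding grid_chain_def by auto
    have mono: "\<And>i j. i \<le> j \<Longrightarrow> j < s \<Longrightarrow> x i \<subseteq> x j" "\<And>i j. i \<le> j \<Longrightarrow> j < t \<Longrightarrow> y i \<subseteq> y j"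
      using x y unfolding rank_enum_def by auto
    from le show ?thesis
    proof
      assume "i \<le> i' \<and> j \<le> j'"
      then show ?thesis unfolding p(1,2) using mono(1)[of i i'] mono(2)[of j j'] lt by blast
    next
      assume "i' \<le> i \<and> j' \<le> j"
      then show ?thesis unfolding p(1,2) using mono(1)[of i' i] mono(2)[of j' j] lt by blast
    qed
  qed
  ultimately show "rank_chain (N + N') (grid_set x y Z)"
    unfolding rank_chain_def using ab(1) by (meson add_le_cancel_left)
  have "inj_on (\<lambda>(i, j). x i \<union> y j) Z"
  proof (rule inj_onI, clarify)
    fix i j i' j' assume p: "(i, j) \<in> Z" "(i', j') \<in> Z" "x i \<union> y j = x i' \<union> y j'"
    then have "i + j = i' + j'" using cd[of i j] cd[of i' j'] by simp
    then show "i = i' \<and> j = j'" using inj p by blast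
  qed
  then show "card (grid_set x y Z) = card Z" by (rule card_image)
qed

lemma grid_set_disjoint:
  assumes x: "rank_enum x l s" and y: "rank_enum y l' t" and IJ: "I \<inter> J = {}"
    and sub: "x ` {..<s} \<subseteq> Pow I" "y ` {..<t} \<subseteq> Pow J"
    and Z: "Z \<subseteq> {..<s} \<times> {..<t}" "Z' \<subseteq> {..<s} \<times> {..<t}" "Z \<inter> Z' = {}"
  shows "grid_set x y Z \<inter> grid_set x y Z' = {}"
proof (rule ccontr)
  assume "grid_set x y Z \<inter> grid_set x y Z' \<noteq> {}"
  then obtain i j i' j' where p: "(i, j) \<in> Z" "(i', j') \<in> Z'" "x i \<union> y j = x i' \<union> y j'" by auto
  then have lt: "i < s" "i' < s" "j < t" "j' < t" using Z by auto
  then have "x i = x i' \<and> y j = y j'"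
    using p(3) sub by (intro join_unique[OF IJ]) auto
  then have "i = i'" "j = j'" using rank_enum_inj[OF x] rank_enum_inj[OF y] lt by auto
  then show False using p Z(3) by auto
qed

lemma grid_set_Times: "grid_set x y (S \<times> T) = x ` S \<otimes> y ` T"
  unfolding join_def by auto

text \<open>The hook runs from \<open>(c, 0)\<close> up to \<open>(c, t - 1 - c)\<close> and on to \<open>(s - 1, t - 1 - c)\<close>.\<close>

lemma grid_chain_hook:
  assumes "c < s" "c < t"
  shows "grid_chain s t {(i, j) \<in> {..<s} \<times> {..<t}. min i (t - 1 - j) = c}" (is "grid_chain s t ?Z")
proof -
  have "(\<lambda>(i, j). i + j) ` ?Z = {c..s + t - 2 - c}"
  proof (intro equalityI subsetI)
    fix r assume r: "r \<in> {c..s + t - 2 - c}"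
    \<comment> \<open>Truncated subtraction joins the two legs of the hook: up to rank
      \<open>t - 1\<close> the first coordinate stays at \<open>c\<close>, beyond it the second
      stays at \<open>t - 1 - c\<close>.\<close>
    have "(c + (r - (t - 1)), min (r - c) (t - 1 - c)) \<in> ?Z"
      using assms r by auto
    moreover have "(c + (r - (t - 1))) + min (r - c) (t - 1 - c) = r"
      using assms r by auto
    ultimately show "r \<in> (\<lambda>(i, j). i + j) ` ?Z" by force
  next
    fix r assume "r \<in> (\<lambda>(i, j). i + j) ` ?Z"
    then obtain i j where "i < s" "j < t" "min i (t - 1 - j) = c" "r = i + j" by auto
    then show "r \<in> {c..s + t - 2 - c}" by (cases "i \<le> t - 1 - j") auto
  qed
  moreover have "c \<le> s + t - 2 - c" "c + (s + t - 2 - c) + 2 = s + t" using assms by auto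
  moreover have "i \<le> i' \<and> j \<le> j' \<or> i' \<le> i \<and> j' \<le> j" 
    if "(i, j) \<in> ?Z" "(i', j') \<in> ?Z" for i j i' j'
  proof -
    have "min i (t - 1 - j) = c" "min i' (t - 1 - j') = c" "j < t" "j' < t" using that by auto
    then show ?thesis by linarith
  qed
  moreover have "?Z \<subseteq> {..<s} \<times> {..<t}" by auto
  ultimately show ?thesis unfolding grid_chain_def by blast
qed

lemma rank_chain_of_enum:
  assumes x: "rank_enum x l s" and "a < b" "b \<le> s"
  shows "rank_chain (2 * l + a + b - 1) (x ` {a..<b})" "card (x ` {a..<b}) = b - a"
proof -
  have inj: "inj_on x {a..<b}" using rank_enum_inj[OF x] assms(3) unfolding inj_on_def by auto
  show "card (x ` {a..<b}) = b - a" using card_image[OF inj] by simp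
  have c: "card (x i) = l + i" if "i < b" for i using x that assms(3) unfolding rank_enum_def by auto
  have "card ` x ` {a..<b} = (\<lambda>i. l + i) ` {a..<b}"
    unfolding image_image using c by (intro image_cong) auto
  also have "\<dots> = {l + a..<l + b}" by (simp add: add.commute)
  also have "\<dots> = {l + a..l + b - 1}" using assms(2) by auto
  finally have "card ` x ` {a..<b} = {l + a..l + b - 1}" .
  moreover have "inj_on card (x ` {a..<b})" unfolding inj_on_def using c by auto
  ultimately have "bij_betw card (x ` {a..<b}) {l + a..l + b - 1}" by (simp add: bij_betw_def)
  moreover have "x i \<subseteq> x j \<or> x j \<subseteq> x i" if "i < b" "j < b" for i j
    using x that assms(3) unfolding rank_enum_def by (meson le_trans less_le_trans nat_le_linear)
  moreover have "l + a \<le> l + b - 1" "(l + a) + (l + b - 1) = 2 * l + a + b - 1" using assms(2) by auto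
  ultimately show "rank_chain (2 * l + a + b - 1) (x ` {a..<b})"
    unfolding rank_chain_def
    by (intro conjI exI[of _ "l + a"] exI[of _ "l + b - 1"]) auto
qed

lemma linkless_chain_subset:
  assumes "linkless_chain F I N k X" "Y \<subseteq> X" "rank_chain M Y" "k' \<le> card Y"
  shows "linkless_chain F I M k' Y"
  using assms unfolding linkless_chain_def by (meson subset_iff)

lemma spans_mono: "spans F I X \<Longrightarrow> X \<subseteq> P \<Longrightarrow> spans F I P"
  unfolding spans_def by auto

lemma grid_chainI:
  assumes "Z \<subseteq> {..<s} \<times> {..<t}" "(\<lambda>(i, j). i + j) ` Z = {a..b}" "a \<le> b" "a + b + 2 = s + t"
    and "\<And>i j i' j'. (i, j) \<in> Z \<Longrightarrow> (i', j') \<in> Z \<Longrightarrow> i \<le> i' \<and> j \<le> j' \<or> i' \<le> i \<and> j' \<le> j"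
  shows "grid_chain s t Z"
  unfolding grid_chain_def using assms by blast

lemma grid_chain_card: 
  assumes "grid_chain s t Z" "(\<lambda>(i, j). i + j) ` Z = {a..b}" shows "b + 1 - a \<le> card Z"
proof -
  have "finite Z" using assms(1) unfolding grid_chain_def by (auto intro: finite_subset)
  then have "card {a..b} \<le> card Z" unfolding assms(2)[symmetric] by (rule card_image_le)
  then show ?thesis by simp
qed

text \<open>Stated for enumerations with a condition on indices, not for linkless chains, because it
  must also apply to the enumeration \<open>v\<close> in \<open>thin_join\<close>, which may contain
  a forbidden link.\<close>

lemma linkless_grid_set:
  assumes splits: "splits F I" "splits F J" and IJ: "I \<inter> J = {}"
    and x: "rank_enum x l s" and y: "rank_enum y l' t"
    and sub: "x ` {..<s} \<subseteq> Pow I" "y ` {..<t} \<subseteq> Pow J"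
    and N: "2 * l + s = N + 1" "2 * l' + t = N' + 1"
    and Z: "grid_chain s t Z" and "r \<le> card Z"
    and linkless: "\<And>i j i' j'. (i, j) \<in> Z \<Longrightarrow> (i', j') \<in> Z \<Longrightarrow> link F (x i) (x i') \<Longrightarrow> link F (y j) (y j') \<Longrightarrow>
      x i \<union> y j = x i' \<union> y j' \<or> x i \<union> y j = {} \<and> x i' \<union> y j' = I \<union> J"
  shows "linkless_chain F (I \<union> J) (N + N') r (grid_set x y Z)"
proof -
  have rk: "rank_chain (N + N') (grid_set x y Z)" "card (grid_set x y Z) = card Z"
    using rank_chain_grid[OF x y IJ sub Z N] by auto
  have sb: "x i \<subseteq> I" "y j \<subseteq> J" if "(i, j) \<in> Z" for i j
  proof -
    have "i < s" "j < t" using Z that unfolding grid_chain_def by auto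
    then show "x i \<subseteq> I" "y j \<subseteq> J" using sub by auto
  qed
  have "u = {} \<and> v = I \<union> J"
    if uv: "u \<in> grid_set x y Z" "v \<in> grid_set x y Z" "link F u v" "u \<noteq> v" for u v
  proof -
    obtain i j i' j' where p: "u = x i \<union> y j" "v = x i' \<union> y j'" "(i, j) \<in> Z" "(i', j') \<in> Z"
      using uv(1,2) by auto
    have "link F (x i) (x i')" "link F (y j) (y j')"
      using link_join[OF splits IJ, of "x i" "y j" "x i'" "y j'"] uv(3) sb[OF p(3)] sb[OF p(4)]
      unfolding p(1,2) by simp_all
    then show ?thesis using linkless[OF p(3,4)] uv(4) unfolding p(1,2) by simp
  qed
  moreover have "grid_set x y Z \<subseteq> Pow (I \<union> J)"
  proof
    fix u assume "u \<in> grid_set x y Z"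
    then obtain i j where "(i, j) \<in> Z" "u = x i \<union> y j" by auto
    then show "u \<in> Pow (I \<union> J)" using sb[of i j] by auto
  qed
  ultimately show ?thesis unfolding linkless_chain_def using rk assms(11) by simp
qed

section \<open>The grid of two enumerated linkless chains\<close>

locale chain_pair =
  fixes F :: "'a set set" and I J X Y N N' k k' x y l l' s t
  assumes splits: "splits F I" "splits F J" and IJ: "I \<inter> J = {}"
    and X: "linkless_chain F I N k X" and Y: "linkless_chain F J N' k' Y"
    and x: "rank_enum x l s" "X = x ` {..<s}" "card X = s" "2 * l + s = N + 1"
    and y: "rank_enum y l' t" "Y = y ` {..<t}" "card Y = t" "2 * l' + t = N' + 1"
begin

lemma sub: "x ` {..<s} \<subseteq> Pow I" "y ` {..<t} \<subseteq> Pow J"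
  using X Y unfolding linkless_chain_def x(2) y(2) by auto

lemma sub': "i < s \<Longrightarrow> x i \<subseteq> I" "j < t \<Longrightarrow> y j \<subseteq> J"
  using sub by auto

end

text \<open>Distinct linked members must be the exempted pair, and members of the least and the
  greatest possible rank can only be the first and the last of the enumeration.\<close>

lemma enum_link:
  assumes X: "linkless_chain F I N k X" and x: "rank_enum x l s" "X = x ` {..<s}"
    and "splits F I" "i < s" "i' < s" "link F (x i) (x i')"
  shows "i = i' \<or> i = 0 \<and> i' = s - 1 \<and> x i = {} \<and> x i' = I \<and> spans F I X"
proof (cases "i = i'")
  case False
  have sub: "x j \<subseteq> I" if "j < s" for j using X x(2) that unfolding linkless_chain_def by auto
  have fin: "finite I" using assms(4) by (simp add: splits_def)
  have "x i \<noteq> x i'" using rank_enum_inj[OF x(1)] assms False by auto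
  then have e: "x i = {}" "x i' = I"
    using X assms(5-7) unfolding linkless_chain_def x(2) by auto
  have "card (x i) = l + i" "card (x i') = l + i'" "card (x (s - 1)) = l + (s - 1)"
    using x(1) assms(5,6) unfolding rank_enum_def by auto
  moreover have "card (x (s - 1)) \<le> card I" using sub assms(5) fin by (intro card_mono) auto
  ultimately have "i = 0" "i' = s - 1" using e assms(6) by auto
  moreover have "spans F I X"
    unfolding spans_def x(2) using e assms(5-7) by (metis imageI lessThan_iff link_ground)
  ultimately show ?thesis using e by simp
qed simp

context chain_pair
begin

text \<open>A link in the product is a link in each coordinate, so each index stays or jumps from
  first to last. Two jumps give the exempted pair; only a single jump along one side of the grid has
  to be excluded. If a side has length 1, its two ends are the same point and no jump occurs, hence
  the conclusions \<open>s = 1\<close> and \<open>t = 1\<close>.\<close>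

lemma grid_linkless:
  assumes Z: "grid_chain s t Z" and "r \<le> card Z"
    and nx: "\<And>j. spans F I X \<Longrightarrow> (0, j) \<in> Z \<Longrightarrow> (s - 1, j) \<in> Z \<Longrightarrow> s = 1"
    and ny: "\<And>i. spans F J Y \<Longrightarrow> (i, 0) \<in> Z \<Longrightarrow> (i, t - 1) \<in> Z \<Longrightarrow> t = 1"
  shows "linkless_chain F (I \<union> J) (N + N') r (grid_set x y Z)"
proof (rule linkless_grid_set[OF splits IJ x(1) y(1) sub x(4) y(4) Z assms(2)])
  fix i j i' j' assume p: "(i, j) \<in> Z" "(i', j') \<in> Z" "link F (x i) (x i')" "link F (y j) (y j')"
  then have b: "i < s" "j < t" "i' < s" "j' < t" using Z unfolding grid_chain_def by auto
  have ij: "i = i' \<or> i = 0 \<and> i' = s - 1 \<and> x i = {} \<and> x i' = I \<and> spans F I X"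
    "j = j' \<or> j = 0 \<and> j' = t - 1 \<and> y j = {} \<and> y j' = J \<and> spans F J Y"
    using enum_link[OF X x(1,2) splits(1) b(1,3) p(3)] enum_link[OF Y y(1,2) splits(2) b(2,4) p(4)] by blast+
  have "\<not> (i = i' \<and> j \<noteq> j')"
  proof
    assume e: "i = i' \<and> j \<noteq> j'"
    then have "t = 1" using ij(2) p(1,2) ny[of i] by auto
    then show False using b e by simp
  qed
  moreover have "\<not> (i \<noteq> i' \<and> j = j')"
  proof
    assume e: "i \<noteq> i' \<and> j = j'"
    then have "s = 1" using ij(1) p(1,2) nx[of j] by auto
    then show False using b e by simp
  qed
  ultimately show "x i \<union> y j = x i' \<union> y j' \<or> x i \<union> y j = {} \<and> x i' \<union> y j' = I \<union> J"
    using ij by auto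
qed

text \<open>If neither factor spans, no index can jump, so the classical nested hooks of a grid
  serve without modification.\<close>

lemma hook_dec:
  assumes "\<not> spans F I X" "\<not> spans F J Y"
  shows "linkless_dec F (I \<union> J) (N + N') 1 (X \<otimes> Y)"
proof -
  define H where "H c = {(i, j) \<in> {..<s} \<times> {..<t}. min i (t - 1 - j) = c}" for c
  have sub: "H c \<subseteq> {..<s} \<times> {..<t}" for c by (auto simp: H_def)
  have "X \<otimes> Y = grid_set x y ({..<s} \<times> {..<t})" unfolding x(2) y(2) grid_set_Times ..
  also have "{..<s} \<times> {..<t} = (\<Union>c\<in>{..<min s t}. H c)" by (auto simp: H_def)
  also have "grid_set x y \<dots> = \<Union>((\<lambda>c. grid_set x y (H c)) ` {..<min s t})" by (rule image_UN)
  finally have e: "X \<otimes> Y = \<Union>((\<lambda>c. grid_set x y (H c)) ` {..<min s t})" .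
  have gc: "grid_chain s t (H c)" if "c < min s t" for c
    using grid_chain_hook[of c s t] that unfolding H_def by auto
  have dec: "linkless_dec F (I \<union> J) (N + N') 1 (grid_set x y (H c))" if c: "c < min s t" for c
  proof (rule linkless_dec_single, rule grid_linkless[OF gc[OF c]])
    have "(c, t - 1 - c) \<in> H c" using c by (auto simp: H_def)
    moreover have "finite (H c)" using sub by (rule finite_subset) auto
    ultimately show "1 \<le> card (H c)" by (metis One_nat_def Suc_leI card_gt_0_iff empty_iff)
  qed (use assms in auto)
  have dis: "grid_set x y (H c) \<inter> grid_set x y (H d) = {}" if "c \<noteq> d" for c d
    by (rule grid_set_disjoint[OF x(1) y(1) IJ chain_pair.sub[OF chain_pair_axioms] sub sub])
      (use that in \<open>auto simp: H_def\<close>)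
  show ?thesis unfolding e
  proof (rule linkless_dec_Union)
    fix P Q assume "P \<in> (\<lambda>c. grid_set x y (H c)) ` {..<min s t}" "Q \<in> (\<lambda>c. grid_set x y (H c)) ` {..<min s t}" "P \<noteq> Q"
    then obtain c d where "P = grid_set x y (H c)" "Q = grid_set x y (H d)" by blast
    then show "P \<inter> Q = {}" using dis[of c d] \<open>P \<noteq> Q\<close> by (cases "c = d") auto
  next
    fix P assume "P \<in> (\<lambda>c. grid_set x y (H c)) ` {..<min s t}"
    then obtain c where "c < min s t" "P = grid_set x y (H c)" by blast
    then show "linkless_dec F (I \<union> J) (N + N') 1 P" using dec by simp
  qed
qed

text \<open>\<open>Z1\<close> is the outer hook without its ends, \<open>Z0\<close> the second hook together with these ends, and
  \<open>R1 \<otimes> R2\<close> the rectangle that remains.\<close>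

lemma corner_split:
  assumes "s \<ge> 3" "t \<ge> 3"
  obtains Z0 Z1 R1 R2 where "X \<otimes> Y = Z0 \<union> Z1 \<union> R1 \<otimes> R2" "Z0 \<inter> Z1 = {}" "(Z0 \<union> Z1) \<inter> (R1 \<otimes> R2) = {}"
    and "linkless_chain F (I \<union> J) (N + N') (s + t - 1) Z0"
    and "linkless_chain F (I \<union> J) (N + N') (s + t - 3) Z1" "{} \<notin> Z1"
    and "linkless_chain F I (N + 2) (s - 2) R1" "{} \<notin> R1"
    and "linkless_chain F J (N' - 2) (t - 2) R2" "J \<notin> R2"
proof -
  \<comment> \<open>The corners are the members through which the legs of the outer hook carry
    links: (0, 0) with (0, t - 1), and (0, t - 1) with (s - 1, t - 1). They fit just below and just
    above the ranks of the second hook, where they can be linked only with each other, which is the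
    exempted pair.\<close>
  define z1 where "z1 = {(i, j) \<in> {..<s} \<times> {..<t}. (i = 0 \<or> j = t - 1) \<and> (i, j) \<noteq> (0, 0) \<and> (i, j) \<noteq> (s - 1, t - 1)}"
  define z0 where "z0 = {(i, j) \<in> {..<s} \<times> {..<t}. (i, j) = (0, 0) \<or> (i, j) = (s - 1, t - 1) \<or>
    1 \<le> i \<and> j \<le> t - 2 \<and> (i = 1 \<or> j = t - 2)}"
  \<comment> \<open>The first factor loses its bottom and the second its top, so neither can span.
    The sums of extreme ranks become \<open>N + 2\<close> and \<open>N' - 2\<close>, with unchanged
    total.\<close>
  define r where "r = {2..<s} \<times> {0..<t - 2}"
  have cov: "{..<s} \<times> {..<t} = z0 \<union> z1 \<union> r" using assms by (auto simp: z0_def z1_def r_def)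
  have bd: "z0 \<subseteq> {..<s} \<times> {..<t}" "z1 \<subseteq> {..<s} \<times> {..<t}" "r \<subseteq> {..<s} \<times> {..<t}" "z0 \<union> z1 \<subseteq> {..<s} \<times> {..<t}"
    by (auto simp: z0_def z1_def r_def)
  have dis: "z0 \<inter> z1 = {}" "(z0 \<union> z1) \<inter> r = {}" using assms by (auto simp: z0_def z1_def r_def)
  have img1: "(\<lambda>(i, j). i + j) ` z1 = {1..s + t - 3}"
  proof (intro equalityI subsetI)
    fix q assume q: "q \<in> {1..s + t - 3}"
    have "(q - (t - 1), min q (t - 1)) \<in> z1" using q assms by (auto simp: z1_def min_def)
    moreover have "q - (t - 1) + min q (t - 1) = q" by auto
    ultimately show "q \<in> (\<lambda>(i, j). i + j) ` z1" by force
  qed (use assms in \<open>auto simp: z1_def\<close>)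
  have img0: "(\<lambda>(i, j). i + j) ` z0 = {0..s + t - 2}"
  proof (intro equalityI subsetI)
    fix q assume q: "q \<in> {0..s + t - 2}"
    consider "q = 0" | "q = s + t - 2" | "1 \<le> q" "q \<le> s + t - 3" using q by fastforce
    then show "q \<in> (\<lambda>(i, j). i + j) ` z0"
    proof cases
      case 1
      have "(0, 0) \<in> z0" using assms by (auto simp: z0_def)
      then show ?thesis using 1 by force
    next
      case 2
      have "(s - 1, t - 1) \<in> z0" "s - 1 + (t - 1) = q" using assms 2 by (auto simp: z0_def)
      then show ?thesis by force
    next
      case 3
      have "(1 + (q - 1 - (t - 2)), min (q - 1) (t - 2)) \<in> z0" using 3 assms by (auto simp: z0_def min_def)
      moreover have "1 + (q - 1 - (t - 2)) + min (q - 1) (t - 2) = q" using 3 by auto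
      ultimately show ?thesis by force
    qed
  qed (use assms in \<open>auto simp: z0_def\<close>)
  have cmp: "i \<le> i' \<and> j \<le> j' \<or> i' \<le> i \<and> j' \<le> j"
    if "(i, j) \<in> z1 \<and> (i', j') \<in> z1 \<or> (i, j) \<in> z0 \<and> (i', j') \<in> z0" for i j i' j'
  proof -
    have b: "i < s" "i' < s" "j < t" "j' < t" using that bd by auto
    from that show ?thesis
    proof
      assume "(i, j) \<in> z1 \<and> (i', j') \<in> z1"
      then have "i = 0 \<or> j = t - 1" "i' = 0 \<or> j' = t - 1" by (auto simp: z1_def)
      with b show ?thesis by linarith
    next
      assume "(i, j) \<in> z0 \<and> (i', j') \<in> z0"
      then have "i = 0 \<and> j = 0 \<or> i = s - 1 \<and> j = t - 1 \<or> 1 \<le> i \<and> j \<le> t - 2 \<and> (i = 1 \<or> j = t - 2)"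
        "i' = 0 \<and> j' = 0 \<or> i' = s - 1 \<and> j' = t - 1 \<or> 1 \<le> i' \<and> j' \<le> t - 2 \<and> (i' = 1 \<or> j' = t - 2)"
        by (auto simp: z0_def)
      with b show ?thesis by linarith
    qed
  qed
  have gc1: "grid_chain s t z1" 
    by (rule grid_chainI[OF bd(2) img1]) (use cmp assms in auto)
  have gc0: "grid_chain s t z0" 
    by (rule grid_chainI[OF bd(1) img0]) (use cmp assms in auto)
  have c1: "s + t - 3 \<le> card z1" using grid_chain_card[OF gc1 img1] by simp
  have c0: "s + t - 1 \<le> card z0" using grid_chain_card[OF gc0 img0] assms by simp
  have card_x: "\<And>i. i < s \<Longrightarrow> card (x i) = l + i" "\<And>i. i < t \<Longrightarrow> card (y i) = l' + i"
    using x(1) y(1) unfolding rank_enum_def by auto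
  have fin: "\<And>i. i < s \<Longrightarrow> finite (x i)" "\<And>i. i < t \<Longrightarrow> finite (y i)"
    using x(1) y(1) unfolding rank_enum_def by auto
  show thesis
  proof (rule that)
    have "X \<otimes> Y = grid_set x y ({..<s} \<times> {..<t})" unfolding x(2) y(2) grid_set_Times ..
    then show "X \<otimes> Y = grid_set x y z0 \<union> grid_set x y z1 \<union> x ` {2..<s} \<otimes> y ` {0..<t - 2}"
      unfolding cov image_Un by (simp add: r_def grid_set_Times)
    show "grid_set x y z0 \<inter> grid_set x y z1 = {}"
      by (rule grid_set_disjoint[OF x(1) y(1) IJ sub bd(1,2) dis(1)])
    show "(grid_set x y z0 \<union> grid_set x y z1) \<inter> (x ` {2..<s} \<otimes> y ` {0..<t - 2}) = {}"
      using grid_set_disjoint[OF x(1) y(1) IJ sub bd(4,3) dis(2)]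
      unfolding image_Un by (simp add: r_def grid_set_Times)
    show "linkless_chain F (I \<union> J) (N + N') (s + t - 1) (grid_set x y z0)"
      by (rule grid_linkless[OF gc0 c0]) (use assms in \<open>auto simp: z0_def\<close>)
    show "linkless_chain F (I \<union> J) (N + N') (s + t - 3) (grid_set x y z1)"
      by (rule grid_linkless[OF gc1 c1]) (use assms in \<open>auto simp: z1_def\<close>)
    show "{} \<notin> grid_set x y z1"
    proof
      assume "{} \<in> grid_set x y z1"
      then obtain i j where p: "(i, j) \<in> z1" "x i = {}" "y j = {}" by auto
      then have "i < s" "j < t" "(i, j) \<noteq> (0, 0)" by (auto simp: z1_def)
      then show False using card_x(1)[of i] card_x(2)[of j] p by auto
    qed
    have r1: "rank_chain (N + 2) (x ` {2..<s})" "card (x ` {2..<s}) = s - 2"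
      using rank_chain_of_enum[OF x(1), of 2 s] x(4) assms by simp_all
    then show "linkless_chain F I (N + 2) (s - 2) (x ` {2..<s})"
      by (intro linkless_chain_subset[OF X]) (auto simp: x(2))
    show "{} \<notin> x ` {2..<s}" using card_x(1) by fastforce
    have "2 * l' + (t - 2) - 1 = N' - 2" using y(4) assms by simp
    then have r2: "rank_chain (N' - 2) (y ` {0..<t - 2})" "card (y ` {0..<t - 2}) = t - 2"
      using rank_chain_of_enum[OF y(1), of 0 "t - 2"] assms by simp_all
    then show "linkless_chain F J (N' - 2) (t - 2) (y ` {0..<t - 2})"
      by (intro linkless_chain_subset[OF Y]) (auto simp: y(2))
    show "J \<notin> y ` {0..<t - 2}"
    proof
      assume "J \<in> y ` {0..<t - 2}"
      then obtain j where j: "j < t - 2" "J = y j" by auto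
      moreover have "card (y (t - 1)) \<le> card J"
        using sub'(2)[of "t - 1"] assms splits(2) by (intro card_mono) (auto simp: splits_def)
      ultimately show False using card_x(2)[of j] card_x(2)[of "t - 1"] assms by auto
    qed
  qed
qed

end

lemma chain_pairE:
  assumes "splits F I" "splits F J" "I \<inter> J = {}"
    and X: "linkless_chain F I N k X" and Y: "linkless_chain F J N' k' Y"
  obtains x y l l' where "chain_pair F I J X Y N N' k k' x y l l' (card X) (card Y)"
proof -
  have "X \<subseteq> Pow I" "Y \<subseteq> Pow J" "finite I" "finite J"
    using assms by (auto simp: linkless_chain_def splits_def)
  then have fin: "u \<in> X \<Longrightarrow> finite u" "u \<in> Y \<Longrightarrow> finite u" for u
    using finite_subset[of u I] finite_subset[of u J] by auto
  obtain x l s where "rank_enum x l s" "X = x ` {..<s}" "card X = s" "2 * l + s = N + 1"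
    using rank_chain_enum[of N X] X fin unfolding linkless_chain_def by metis
  moreover obtain y l' t where "rank_enum y l' t" "Y = y ` {..<t}" "card Y = t" "2 * l' + t = N' + 1"
    using rank_chain_enum[of N' Y] Y fin unfolding linkless_chain_def by metis
  ultimately show thesis using that[of x y l l'] assms by (simp add: chain_pair_def)
qed

section \<open>Products of partitions\<close>

lemma join_Union: "\<Union>\<D> \<otimes> Q = (\<Union>X\<in>\<D>. X \<otimes> Q)"
proof (rule set_eqI)
  fix w show "w \<in> \<Union>\<D> \<otimes> Q \<longleftrightarrow> w \<in> (\<Union>X\<in>\<D>. X \<otimes> Q)"
    unfolding join_def by simp
qed

lemma join_partition:
  assumes P: "partition_on P \<D>" "P \<subseteq> Pow I" and Q: "partition_on Q \<E>" "Q \<subseteq> Pow J" and IJ: "I \<inter> J = {}"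
  shows "P \<otimes> Q = \<Union>((\<lambda>(X, Y). X \<otimes> Y) ` (\<D> \<times> \<E>))"
    and "A \<in> (\<lambda>(X, Y). X \<otimes> Y) ` (\<D> \<times> \<E>) \<Longrightarrow> B \<in> (\<lambda>(X, Y). X \<otimes> Y) ` (\<D> \<times> \<E>) \<Longrightarrow>
      A \<noteq> B \<Longrightarrow> A \<inter> B = {}"
proof -
  let ?P = "(\<lambda>(X, Y). X \<otimes> Y) ` (\<D> \<times> \<E>)"
  have "P \<otimes> Q = \<Union>\<D> \<otimes> \<Union>\<E>" using P(1) Q(1) by (simp add: partition_on_def)
  also have "\<dots> = (\<Union>X\<in>\<D>. \<Union>Y\<in>\<E>. X \<otimes> Y)"
  proof -
    have "X \<otimes> \<Union>\<E> = (\<Union>Y\<in>\<E>. X \<otimes> Y)" for X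
      using join_Union[of \<E> X] by (simp add: join_commute)
    then show ?thesis unfolding join_Union by simp
  qed
  also have "\<dots> = \<Union>?P" by auto
  finally show "P \<otimes> Q = \<Union>?P" .
  show "A \<inter> B = {}" if "A \<in> ?P" "B \<in> ?P" and ne: "A \<noteq> B"
  proof -
    from that obtain X Y X' Y' where XY: "X \<in> \<D>" "Y \<in> \<E>" "A = X \<otimes> Y" "X' \<in> \<D>" "Y' \<in> \<E>" "B = X' \<otimes> Y'"
      by auto
    have "X \<subseteq> P" "X' \<subseteq> P" "Y \<subseteq> Q" "Y' \<subseteq> Q"
      using XY P(1) Q(1) unfolding partition_on_def by auto
    then have sub: "X \<subseteq> Pow I" "X' \<subseteq> Pow I" "Y \<subseteq> Pow J" "Y' \<subseteq> Pow J"
      using P(2) Q(2) by (meson subset_trans)+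
    have "X \<noteq> X' \<or> Y \<noteq> Y'" using ne XY by auto
    then have "X \<inter> X' = {} \<or> Y \<inter> Y' = {}"
      using P(1) Q(1) XY by (meson disjointD partition_onD2)
    then show ?thesis
    proof
      assume "X \<inter> X' = {}"
      then show ?thesis unfolding XY(3,6) using join_disjoint[OF IJ sub] by simp
    next
      assume "Y \<inter> Y' = {}"
      moreover have "J \<inter> I = {}" using IJ by auto
      ultimately show ?thesis
        unfolding XY(3,6) join_commute[of X] join_commute[of X'] using join_disjoint[OF _ sub(3,4,1,2)] by simp
    qed
  qed
qed

lemma partition_on_join:
  assumes P: "partition_on P \<D>" "P \<subseteq> Pow I" and Q: "partition_on Q \<E>" "Q \<subseteq> Pow J" and IJ: "I \<inter> J = {}"
  shows "partition_on (P \<otimes> Q) ((\<lambda>(X, Y). X \<otimes> Y) ` (\<D> \<times> \<E>))" (is "partition_on _ ?P")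
proof (rule partition_onI)
  show "\<Union>?P = P \<otimes> Q" using join_partition(1)[OF assms] ..
  show "disjnt A B" if "A \<in> ?P" "B \<in> ?P" "A \<noteq> B" for A B
    using join_partition(2)[OF assms that] by (simp add: disjnt_def)
  show "{} \<notin> ?P"
  proof
    assume "{} \<in> ?P"
    then obtain X Y where XY: "X \<in> \<D>" "Y \<in> \<E>" "X \<otimes> Y = {}" by auto
    then have "X \<noteq> {}" "Y \<noteq> {}" using P(1) Q(1) unfolding partition_on_def by auto
    then show False using XY(3) unfolding join_def by auto
  qed
qed

lemma join_partition_dec:
  assumes P: "partition_on P \<D>" "P \<subseteq> Pow I" and Q: "partition_on Q \<E>" "Q \<subseteq> Pow J" and IJ: "I \<inter> J = {}"
    and dec: "\<And>X Y. X \<in> \<D> \<Longrightarrow> Y \<in> \<E> \<Longrightarrow> linkless_dec F M n k (X \<otimes> Y)"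
  shows "linkless_dec F M n k (P \<otimes> Q)"
  unfolding join_partition(1)[OF assms(1-5)]
proof (rule linkless_dec_Union)
  let ?P = "(\<lambda>(X, Y). X \<otimes> Y) ` (\<D> \<times> \<E>)"
  show "A \<inter> B = {}" if "A \<in> ?P" "B \<in> ?P" "A \<noteq> B" for A B
    using join_partition(2)[OF assms(1-5) that] .
  fix A assume "A \<in> ?P"
  then show "linkless_dec F M n k A" using dec by (elim imageE SigmaE) simp
qed

lemma spans_card:
  assumes "linkless_chain F I N k X" "splits F I" "spans F I X" shows "3 \<le> card X"
proof -
  have r: "rank_chain N X" and s: "{} \<in> X" "I \<in> X"
    using assms(1,3) by (simp_all add: linkless_chain_def spans_def)
  obtain l h where b: "bij_betw card X {l..h}" using r unfolding rank_chain_def by auto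
  have "card {} \<in> {l..h}" "card I \<in> {l..h}" 
    using bspec[OF bij_betwE[OF b] s(1)] bspec[OF bij_betwE[OF b] s(2)] by simp_all
  moreover have "2 \<le> card I" using assms(2) by (simp add: splits_def)
  ultimately have "3 \<le> h + 1 - l" by simp
  then show ?thesis using bij_betw_same_card[OF b] by simp
qed

text \<open>A spanning chain has at least three members by \<open>spans_card\<close>, so a lower
  bound is demanded only of its partner; then the corner construction applies, and the hooks take
  the rest. The length guaranteed afterwards is only 1, since the innermost hook can be a single
  point.\<close>

theorem join_dec:
  assumes sp: "splits F I" "splits F J" and IJ: "I \<inter> J = {}"
    and P: "linkless_dec F I N k P" and Q: "linkless_dec F J N' k' Q"
    and k: "3 \<le> k \<or> \<not> spans F J Q" "3 \<le> k' \<or> \<not> spans F I P"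
  shows "linkless_dec F (I \<union> J) (N + N') 1 (P \<otimes> Q)"
proof -
  obtain \<D> where D: "partition_on P \<D>" "\<And>X. X \<in> \<D> \<Longrightarrow> linkless_chain F I N k X"
    using P unfolding linkless_dec_def by auto
  obtain \<E> where E: "partition_on Q \<E>" "\<And>X. X \<in> \<E> \<Longrightarrow> linkless_chain F J N' k' X"
    using Q unfolding linkless_dec_def by auto
  show ?thesis
  proof (rule join_partition_dec[OF D(1) linkless_dec_subset[OF P] E(1) linkless_dec_subset[OF Q] IJ])
    fix X Y assume XY: "X \<in> \<D>" "Y \<in> \<E>"
    note X = D(2)[OF XY(1)] and Y = E(2)[OF XY(2)]
    have subs: "X \<subseteq> P" "Y \<subseteq> Q" using D(1) E(1) XY unfolding partition_on_def by auto
    obtain x y l l' where "chain_pair F I J X Y N N' k k' x y l l' (card X) (card Y)"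
      using chain_pairE[OF sp IJ X Y] by blast
    then interpret chain_pair F I J X Y N N' k k' x y l l' "card X" "card Y" .
    show "linkless_dec F (I \<union> J) (N + N') 1 (X \<otimes> Y)"
    proof (cases "spans F I X \<or> spans F J Y")
      case False
      then show ?thesis using hook_dec by blast
    next
      case True
      have "3 \<le> card X \<and> 3 \<le> card Y"
        using True
      proof
        assume "spans F I X"
        then have "3 \<le> card X" "3 \<le> k'" using spans_card[OF X sp(1)] spans_mono[of F I X P] k(2) subs by auto
        then show ?thesis using Y by (simp add: linkless_chain_def)
      next
        assume "spans F J Y"
        then have "3 \<le> card Y" "3 \<le> k" using spans_card[OF Y sp(2)] spans_mono[of F J Y Q] k(1) subs by auto
        then show ?thesis using X by (simp add: linkless_chain_def)
      qed
      then have c3: "3 \<le> card X" "3 \<le> card Y" by auto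
      obtain Z0 Z1 R1 R2 where S: "X \<otimes> Y = Z0 \<union> Z1 \<union> R1 \<otimes> R2" "Z0 \<inter> Z1 = {}" "(Z0 \<union> Z1) \<inter> (R1 \<otimes> R2) = {}"
        "linkless_chain F (I \<union> J) (N + N') (card X + card Y - 1) Z0"
        "linkless_chain F (I \<union> J) (N + N') (card X + card Y - 3) Z1" "{} \<notin> Z1"
        "linkless_chain F I (N + 2) (card X - 2) R1" "{} \<notin> R1"
        "linkless_chain F J (N' - 2) (card Y - 2) R2" "J \<notin> R2"
        using corner_split[OF c3] by metis
      obtain x' y' m m' where cp: "chain_pair F I J R1 R2 (N + 2) (N' - 2) (card X - 2) (card Y - 2) x' y' m m' (card R1) (card R2)"
        using chain_pairE[OF sp IJ S(7,9)] by blast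
      have "N + 2 + (N' - 2) = N + N'" using y(4) c3 by simp
      then have "linkless_dec F (I \<union> J) (N + N') 1 (R1 \<otimes> R2)"
        using chain_pair.hook_dec[OF cp] S(8,10) by (simp only: spans_def simp_thms)
      moreover have "linkless_dec F (I \<union> J) (N + N') 1 Z0" "linkless_dec F (I \<union> J) (N + N') 1 Z1"
        using linkless_dec_single[OF S(4)] linkless_dec_single[OF S(5)] c3 by (auto elim: linkless_dec_mono)
      ultimately show ?thesis unfolding S(1) using S(2,3) by (intro linkless_dec_Un) auto
    qed
  qed
qed

text \<open>Sides of at least five leave pieces that may still meet spanning factors:
  \<open>s + t - 3 \<ge> 7\<close> and \<open>s - 2, t - 2 \<ge> 3\<close>. The bound 5 recorded for
  \<open>Z0\<close> and \<open>Z1\<close> lets such a piece act as a long factor in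
  \<open>thin_join\<close>.\<close>

lemma corner_pieces:
  assumes "splits F I" "splits F J" "I \<inter> J = {}" "linkless_chain F I N k X" "linkless_chain F J N' k' Y"
    and "5 \<le> card X" "5 \<le> card Y"
  obtains Z0 Z1 R1 R2 where "X \<otimes> Y = Z0 \<union> Z1 \<union> R1 \<otimes> R2" "Z0 \<inter> Z1 = {}" "(Z0 \<union> Z1) \<inter> (R1 \<otimes> R2) = {}"
    and "linkless_chain F (I \<union> J) (N + N') 5 Z0"
    and "linkless_chain F (I \<union> J) (N + N') 5 Z1" "{} \<notin> Z1"
    and "linkless_chain F I (N + 2) 3 R1" "{} \<notin> R1"
    and "linkless_chain F J (N' - 2) 3 R2" "J \<notin> R2" "2 \<le> N'"
proof -
  obtain x y l l' where "chain_pair F I J X Y N N' k k' x y l l' (card X) (card Y)"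
    using chain_pairE[OF assms(1-5)] by blast
  then interpret chain_pair F I J X Y N N' k k' x y l l' "card X" "card Y" .
  have c3: "3 \<le> card X" "3 \<le> card Y" using assms(6,7) by auto
  obtain Z0 Z1 R1 R2 where S: "X \<otimes> Y = Z0 \<union> Z1 \<union> R1 \<otimes> R2" "Z0 \<inter> Z1 = {}" "(Z0 \<union> Z1) \<inter> (R1 \<otimes> R2) = {}"
    "linkless_chain F (I \<union> J) (N + N') (card X + card Y - 1) Z0"
    "linkless_chain F (I \<union> J) (N + N') (card X + card Y - 3) Z1" "{} \<notin> Z1"
    "linkless_chain F I (N + 2) (card X - 2) R1" "{} \<notin> R1"
    "linkless_chain F J (N' - 2) (card Y - 2) R2" "J \<notin> R2"
    using corner_split[OF c3] by metis
  have weaken: "linkless_chain F G n r Z" if "linkless_chain F G n r' Z" "r \<le> r'" for G n r r' Z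
    using that unfolding linkless_chain_def by auto
  show thesis
    by (rule that[OF S(1-3) weaken[OF S(4)] weaken[OF S(5)] S(6) weaken[OF S(7)] S(8) weaken[OF S(9)] S(10)])
      (use assms(6,7) y(4) in auto)
qed

text \<open>\<open>Q\<close> may span and may have short chains, so it first meets
  \<open>R2\<close>, which is long enough and does not span. The product inherits non-spanning from
  \<open>R2\<close> and can then meet \<open>R1\<close>.\<close>

lemma rect_join:
  assumes "splits F I" "splits F J" "splits F K" "I \<inter> J = {}" "I \<inter> K = {}" "J \<inter> K = {}"
    and R1: "linkless_chain F I N 3 R1" "{} \<notin> R1" and R2: "linkless_chain F J N' 3 R2" "J \<notin> R2"
    and Q: "linkless_dec F K M k Q"
  shows "linkless_dec F (I \<union> J \<union> K) (N + N' + M) 1 (R1 \<otimes> R2 \<otimes> Q)"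
proof -
  have d: "linkless_dec F I N 3 R1" "linkless_dec F J N' 3 R2"
    using linkless_dec_single[OF R1(1)] linkless_dec_single[OF R2(1)] by auto
  have ns: "\<not> spans F I R1" "\<not> spans F J R2" using R1(2) R2(2) by (auto simp: spans_def)
  have sub: "R2 \<subseteq> Pow J" "Q \<subseteq> Pow K" using linkless_dec_subset[OF d(2)] linkless_dec_subset[OF Q] by auto
  have "linkless_dec F (J \<union> K) (N' + M) 1 (R2 \<otimes> Q)"
    by (rule join_dec[OF assms(2,3,6) d(2) Q]) (use ns in auto)
  moreover have "\<not> spans F (J \<union> K) (R2 \<otimes> Q)" using spans_join[OF assms(2,3,6) sub] ns by blast
  moreover have "I \<inter> (J \<union> K) = {}" using assms(4,5) by auto
  ultimately have "linkless_dec F (I \<union> (J \<union> K)) (N + (N' + M)) 1 (R1 \<otimes> (R2 \<otimes> Q))"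
    using ns by (intro join_dec[OF assms(1) splits_Un[OF assms(2,3,6)] _ d(1)]) auto
  then show ?thesis by (simp only: join_assoc Un_assoc add.assoc)
qed

text \<open>\<open>rect_join\<close> settles the rectangle for every \<open>Q\<close>. Only the two
  long chains remain, and \<open>step\<close> leaves to the application how each of them is joined
  with \<open>Q\<close>.\<close>

lemma corner_join:
  assumes "splits F I" "splits F J" "splits F K" "I \<inter> J = {}" "I \<inter> K = {}" "J \<inter> K = {}"
    and X: "linkless_chain F I N k X" "5 \<le> card X" and Y: "linkless_chain F J N' k' Y" "5 \<le> card Y"
    and Q: "linkless_dec F K M k'' Q"
    and step: "\<And>Z. linkless_chain F (I \<union> J) (N + N') 5 Z \<Longrightarrow> linkless_dec F (I \<union> J \<union> K) (N + N' + M) 1 (Z \<otimes> Q)"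
  shows "linkless_dec F (I \<union> J \<union> K) (N + N' + M) 1 (X \<otimes> Y \<otimes> Q)"
proof -
  obtain Z0 Z1 R1 R2 where S: "X \<otimes> Y = Z0 \<union> Z1 \<union> R1 \<otimes> R2" "Z0 \<inter> Z1 = {}" "(Z0 \<union> Z1) \<inter> (R1 \<otimes> R2) = {}"
    "linkless_chain F (I \<union> J) (N + N') 5 Z0" "linkless_chain F (I \<union> J) (N + N') 5 Z1" "{} \<notin> Z1"
    "linkless_chain F I (N + 2) 3 R1" "{} \<notin> R1" "linkless_chain F J (N' - 2) 3 R2" "J \<notin> R2" "2 \<le> N'"
    using corner_pieces[OF assms(1,2,4) X(1) Y(1) X(2) Y(2)] by metis
  have sub: "Z0 \<subseteq> Pow (I \<union> J)" "Z1 \<subseteq> Pow (I \<union> J)" "R1 \<otimes> R2 \<subseteq> Pow (I \<union> J)" "Q \<subseteq> Pow K"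
    using S(4,5) join_subset_Pow[of R1 I R2 J] S(7,9) linkless_dec_subset[OF Q] by (auto simp: linkless_chain_def)
  have e: "N + 2 + (N' - 2) + M = N + N' + M" using S(11) by simp
  have "linkless_dec F (I \<union> J \<union> K) (N + N' + M) 1 (R1 \<otimes> R2 \<otimes> Q)"
    using rect_join[OF assms(1-6) S(7-10) Q] unfolding e .
  moreover have K: "(I \<union> J) \<inter> K = {}" using assms(5,6) by auto
  have "(Z0 \<otimes> Q) \<inter> (Z1 \<otimes> Q) = {}" using join_disjoint[OF K sub(1,2,4,4) S(2)] .
  moreover have "(Z0 \<otimes> Q \<union> Z1 \<otimes> Q) \<inter> (R1 \<otimes> R2 \<otimes> Q) = {}"
    using join_disjoint[OF K _ sub(3,4,4) S(3)] sub(1,2) unfolding join_Un[symmetric] by simp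
  ultimately show ?thesis unfolding S(1) join_Un
    using step[OF S(4)] step[OF S(5)] by (intro linkless_dec_Un)
qed

section \<open>A two-element chain times full chains\<close>

text \<open>
  The longest chain \<open>v\<close> of the product of a two-element chain with a full chain of \<open>s + 5\<close> elements has
  \<open>s + 6\<close> elements, with the linked pair \<open>v 0\<close>, \<open>v (s + 4)\<close>. Its product with a full chain of \<open>t + 5\<close>
  elements must avoid the pairs \<open>(0, j)\<close>, \<open>(s + 4, j)\<close> and \<open>(i, 0)\<close>, \<open>(i, t + 4)\<close> as well as
  \<open>(0, 0)\<close>, \<open>(s + 4, t + 4)\<close>. To this end the elements of the three outer hooks are exchanged near their ends.
\<close>

definition thin0 :: "nat \<Rightarrow> nat \<Rightarrow> (nat \<times> nat) set" where
  "thin0 s t = {(i, j) \<in> {..<s + 6} \<times> {..<t + 5}. i = 0 \<and> j = 0 \<or> i = 1 \<and> j = 0 \<or>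
     i = s + 5 \<and> j = t + 3 \<or> i = s + 5 \<and> j = t + 4 \<or> 2 \<le> i \<and> j \<le> t + 2 \<and> (i = 2 \<or> j = t + 2)}"

definition thin1 :: "nat \<Rightarrow> nat \<Rightarrow> (nat \<times> nat) set" where
  "thin1 s t = {(i, j) \<in> {..<s + 6} \<times> {..<t + 5}. i = 0 \<and> j = 1 \<or> i = s + 4 \<and> j = t + 4 \<or>
     1 \<le> i \<and> j \<le> t + 3 \<and> (i = 1 \<or> j = t + 3) \<and> 2 \<le> i + j \<and> i + j \<le> s + t + 7}"

definition thin2 :: "nat \<Rightarrow> nat \<Rightarrow> (nat \<times> nat) set" where
  "thin2 s t = {(i, j) \<in> {..<s + 6} \<times> {..<t + 5}. (i = 0 \<or> j = t + 4) \<and> 2 \<le> i + j \<and> i + j \<le> s + t + 7}"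

lemma mem_thin:
  "(i, j) \<in> thin0 s t \<longleftrightarrow> i < s + 6 \<and> j < t + 5 \<and> (i = 0 \<and> j = 0 \<or> i = 1 \<and> j = 0 \<or>
     i = s + 5 \<and> j = t + 3 \<or> i = s + 5 \<and> j = t + 4 \<or> 2 \<le> i \<and> j \<le> t + 2 \<and> (i = 2 \<or> j = t + 2))"
  "(i, j) \<in> thin1 s t \<longleftrightarrow> i < s + 6 \<and> j < t + 5 \<and> (i = 0 \<and> j = 1 \<or> i = s + 4 \<and> j = t + 4 \<or>
     1 \<le> i \<and> j \<le> t + 3 \<and> (i = 1 \<or> j = t + 3) \<and> 2 \<le> i + j \<and> i + j \<le> s + t + 7)"
  "(i, j) \<in> thin2 s t \<longleftrightarrow> i < s + 6 \<and> j < t + 5 \<and> (i = 0 \<or> j = t + 4) \<and> 2 \<le> i + j \<and> i + j \<le> s + t + 7"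
  unfolding thin0_def thin1_def thin2_def by simp_all

lemma image_sum_eqI:
  assumes "\<And>i j. (i, j) \<in> c \<Longrightarrow> a \<le> i + j \<and> i + j \<le> b"
    and "\<And>q. a \<le> q \<Longrightarrow> q \<le> b \<Longrightarrow> \<exists>i j. (i, j) \<in> c \<and> i + j = q"
  shows "(\<lambda>(i, j). i + j) ` c = {a..b::nat}"
proof (intro equalityI subsetI)
  fix q assume "q \<in> (\<lambda>(i, j). i + j) ` c"
  then obtain p where "p \<in> c" "q = (\<lambda>(i, j). i + j) p" by blast
  then show "q \<in> {a..b}" using assms(1)[of "fst p" "snd p"] by (simp add: case_prod_unfold)
next
  fix q assume "q \<in> {a..b}"
  then obtain i j where "(i, j) \<in> c" "i + j = q" using assms(2)[of q] by auto
  then show "q \<in> (\<lambda>(i, j). i + j) ` c" by (intro image_eqI[of _ _ "(i, j)"]) simp_all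
qed

lemma grid_chain_thin2:
  shows "grid_chain (s + 6) (t + 5) (thin2 s t)" "thin2 s t \<noteq> {}"
proof -
  have img: "(\<lambda>(i, j). i + j) ` thin2 s t = {2..s + t + 7}"
  proof (rule image_sum_eqI)
    fix i j assume "(i, j) \<in> thin2 s t"
    then show "2 \<le> i + j \<and> i + j \<le> s + t + 7" unfolding mem_thin by linarith
  next
    fix q assume q: "2 \<le> q" "q \<le> s + t + 7"
    show "\<exists>i j. (i, j) \<in> thin2 s t \<and> i + j = q"
    proof (cases "q \<le> t + 4")
      case True
      have "(0, q) \<in> thin2 s t" "0 + q = q" using True q by (auto simp: mem_thin)
      then show ?thesis by blast
    next
      case False
      have "(q - (t + 4), t + 4) \<in> thin2 s t" "q - (t + 4) + (t + 4) = q"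
        using False q by (auto simp: mem_thin)
      then show ?thesis by blast
    qed
  qed
  show "grid_chain (s + 6) (t + 5) (thin2 s t)"
  proof (rule grid_chainI[OF _ img])
    show "thin2 s t \<subseteq> {..<s + 6} \<times> {..<t + 5}" unfolding thin2_def by auto
    fix i j i' j' assume p: "(i, j) \<in> thin2 s t" "(i', j') \<in> thin2 s t"
    show "i \<le> i' \<and> j \<le> j' \<or> i' \<le> i \<and> j' \<le> j" using p unfolding mem_thin by linarith
  qed auto
  show "thin2 s t \<noteq> {}" using img by auto
qed

lemma grid_chain_thin1:
  shows "grid_chain (s + 6) (t + 5) (thin1 s t)" "thin1 s t \<noteq> {}"
proof -
  have img: "(\<lambda>(i, j). i + j) ` thin1 s t = {1..s + t + 8}"
  proof (rule image_sum_eqI)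
    fix i j assume "(i, j) \<in> thin1 s t"
    then show "1 \<le> i + j \<and> i + j \<le> s + t + 8" unfolding mem_thin by linarith
  next
    fix q assume q: "1 \<le> q" "q \<le> s + t + 8"
    consider "q = 1" | "q = s + t + 8" | "2 \<le> q" "q \<le> s + t + 7" using q by linarith
    then show "\<exists>i j. (i, j) \<in> thin1 s t \<and> i + j = q"
    proof cases
      case 1
      have "(0, 1) \<in> thin1 s t" "0 + (1) = q" using q 1 by (auto simp: mem_thin)
      then show ?thesis by blast
    next
      case 2
      have "(s + 4, t + 4) \<in> thin1 s t" "s + 4 + (t + 4) = q" using q 2 by (auto simp: mem_thin)
      then show ?thesis by blast
    next
      case 3
      show ?thesis
      proof (cases "q - 1 \<le> t + 3")
        case True
        have "(1, q - 1) \<in> thin1 s t" "1 + (q - 1) = q" using True q 3 by (auto simp: mem_thin)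
        then show ?thesis by blast
      next
        case False
        have "(q - (t + 3), t + 3) \<in> thin1 s t" "q - (t + 3) + (t + 3) = q"
          using False q 3 by (auto simp: mem_thin)
        then show ?thesis by blast
      qed
    qed
  qed
  show "grid_chain (s + 6) (t + 5) (thin1 s t)"
  proof (rule grid_chainI[OF _ img])
    show "thin1 s t \<subseteq> {..<s + 6} \<times> {..<t + 5}" unfolding thin1_def by auto
    fix i j i' j' assume p: "(i, j) \<in> thin1 s t" "(i', j') \<in> thin1 s t"
    show "i \<le> i' \<and> j \<le> j' \<or> i' \<le> i \<and> j' \<le> j" using p unfolding mem_thin by linarith
  qed auto
  show "thin1 s t \<noteq> {}" using img by auto
qed

lemma grid_chain_thin0:
  shows "grid_chain (s + 6) (t + 5) (thin0 s t)" "thin0 s t \<noteq> {}"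
proof -
  have img: "(\<lambda>(i, j). i + j) ` thin0 s t = {0..s + t + 9}"
  proof (rule image_sum_eqI)
    fix i j assume "(i, j) \<in> thin0 s t"
    then show "0 \<le> i + j \<and> i + j \<le> s + t + 9" unfolding mem_thin by linarith
  next
    fix q assume q: "0 \<le> q" "q \<le> s + t + 9"
    consider "q = 0" | "q = 1" | "q = s + t + 8" | "q = s + t + 9" | "2 \<le> q" "q \<le> s + t + 7" using q by linarith
    then show "\<exists>i j. (i, j) \<in> thin0 s t \<and> i + j = q"
    proof cases
      case 1
      have "(0, 0) \<in> thin0 s t" "0 + 0 = q" using q 1 by (auto simp: mem_thin)
      then show ?thesis by blast
    next
      case 2
      have "(1, 0) \<in> thin0 s t" "1 + (0) = q" using q 2 by (auto simp: mem_thin)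
      then show ?thesis by blast
    next
      case 3
      have "(s + 5, t + 3) \<in> thin0 s t" "s + 5 + (t + 3) = q" using q 3 by (auto simp: mem_thin)
      then show ?thesis by blast
    next
      case 4
      have "(s + 5, t + 4) \<in> thin0 s t" "s + 5 + (t + 4) = q" using q 4 by (auto simp: mem_thin)
      then show ?thesis by blast
    next
      case 5
      show ?thesis
      proof (cases "q - 2 \<le> t + 2")
        case True
        have "(2, q - 2) \<in> thin0 s t" "2 + (q - 2) = q" using True q 5 by (auto simp: mem_thin)
        then show ?thesis by blast
      next
        case False
        have "(q - (t + 2), t + 2) \<in> thin0 s t" "q - (t + 2) + (t + 2) = q"
          using False q 5 by (auto simp: mem_thin)
        then show ?thesis by blast
      qed
    qed
  qed
  show "grid_chain (s + 6) (t + 5) (thin0 s t)"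
  proof (rule grid_chainI[OF _ img])
    show "thin0 s t \<subseteq> {..<s + 6} \<times> {..<t + 5}" unfolding thin0_def by auto
    fix i j i' j' assume p: "(i, j) \<in> thin0 s t" "(i', j') \<in> thin0 s t"
    show "i \<le> i' \<and> j \<le> j' \<or> i' \<le> i \<and> j' \<le> j" using p unfolding mem_thin by linarith
  qed auto
  show "thin0 s t \<noteq> {}" using img by auto
qed

lemma thin_disjoint:
  "thin0 s t \<inter> thin1 s t = {}" "(thin0 s t \<union> thin1 s t) \<inter> thin2 s t = {}"
  "(thin0 s t \<union> thin1 s t \<union> thin2 s t) \<inter> ({3..<s + 6} \<times> {0..<t + 2}) = {}"
  by (auto simp: mem_thin)

lemma thin_cover:
  "{..<s + 6} \<times> {..<t + 5} = thin0 s t \<union> thin1 s t \<union> thin2 s t \<union> {3..<s + 6} \<times> {0..<t + 2}"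
proof (intro equalityI subsetI)
  fix p assume "p \<in> {..<s + 6} \<times> {..<t + 5}"
  then obtain i j where p: "p = (i, j)" "i < s + 6" "j < t + 5" by auto
  have i: "i = 0 \<or> i = 1 \<or> i = 2 \<or> 3 \<le> i" by linarith
  have j: "j = t + 4 \<or> j = t + 3 \<or> j = t + 2 \<or> j < t + 2" using p(3) by linarith
  from i j show "p \<in> thin0 s t \<union> thin1 s t \<union> thin2 s t \<union> {3..<s + 6} \<times> {0..<t + 2}"
    using p by (elim disjE) (auto simp: mem_thin)
qed (auto simp: mem_thin)

text \<open>\<open>thin2\<close> is the outer hook cut down to the ranks of the third. Its members
  (0, 1) and (s + 4, t + 4) replace the ends of the middle hook in \<open>thin1\<close>; these ends
  and the two corners of the grid extend the third hook to \<open>thin0\<close>. In each of the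
  three sets, indices 0 and \<open>s + 4\<close> of the first side never occur with a common second
  index, nor 0 and \<open>t + 4\<close> of the second side with a common first index, and (0, 0) and
  (s + 4, t + 4) lie in different sets.\<close>

lemma thin_linkless:
  assumes "c \<in> {thin0 s t, thin1 s t, thin2 s t}" "(i, j) \<in> c" "(i', j') \<in> c"
    "i = i' \<or> i = 0 \<and> i' = s + 4" "j = j' \<or> j = 0 \<and> j' = t + 4"
  shows "i = i' \<and> j = j'"
  using assms by (auto simp: mem_thin)

lemma linkless_chain_enum:
  assumes "linkless_chain F I N k X" "finite I"
  obtains x l where "rank_enum x l (card X)" "X = x ` {..<card X}" "2 * l + card X = N + 1"
proof -
  have "u \<in> X \<Longrightarrow> finite u" for u
    using assms finite_subset[of u I] by (auto simp: linkless_chain_def)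
  then obtain x l s where "rank_enum x l s" "X = x ` {..<s}" "card X = s" "2 * l + s = N + 1"
    using rank_chain_enum[of N X] assms(1) unfolding linkless_chain_def by metis
  then show thesis using that by simp
qed

text \<open>A grid with two rows and at least three columns has only two symmetric chain
  decompositions: the long chain contains one row entirely and changes rows at an end of it. If
  \<open>Y\<close> spans, the ends of that row are linked without being the exempted pair, so
  \<open>X \<otimes> Y\<close> cannot be settled before \<open>Z\<close> enters.\<close>

lemma thin_join:
  assumes "splits F I" "splits F J" "splits F K" "I \<inter> J = {}" "I \<inter> K = {}" "J \<inter> K = {}"
    and X: "linkless_chain F I N k X" "card X = 2" and Y: "linkless_chain F J N' k' Y" "5 \<le> card Y"
    and Z: "linkless_chain F K M k'' Z" "5 \<le> card Z"
  shows "linkless_dec F (I \<union> J \<union> K) (N + N' + M) 1 (X \<otimes> Y \<otimes> Z)"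
proof -
  obtain x y l l' where "chain_pair F I J X Y N N' k k' x y l l' (card X) (card Y)"
    using chain_pairE[OF assms(1,2,4) X(1) Y(1)] by blast
  then interpret XY: chain_pair F I J X Y N N' k k' x y l l' "card X" "card Y" .
  have K: "(I \<union> J) \<inter> K = {}" using assms(5,6) by auto
  note sIJ = splits_Un[OF assms(1,2,4)]
  have "finite K" using assms(3) by (simp add: splits_def)
  then obtain z lz where z: "rank_enum z lz (card Z)" "Z = z ` {..<card Z}" "2 * lz + card Z = M + 1"
    using linkless_chain_enum[OF Z(1)] by metis
  obtain s where s: "card Y = s + 5" using Y(2) by (metis add.commute le_iff_add)
  obtain t where t: "card Z = t + 5" using Z(2) by (metis add.commute le_iff_add)
  note x = XY.x[unfolded X(2)] and y = XY.y[unfolded s] and z = z[unfolded t]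
  have subx: "x 0 \<subseteq> I" "x 1 \<subseteq> I" and suby: "\<And>j. j < s + 5 \<Longrightarrow> y j \<subseteq> J"
    using XY.sub' X(2) s by simp_all
  have nX: "\<not> spans F I X" using spans_card[OF X(1) assms(1)] X(2) by auto
  have lx: "i = i'" if "i < 2" "i' < 2" "link F (x i) (x i')" for i i'
    using enum_link[OF X(1) x(1,2) assms(1) that] nX by blast
  define v where "v j = (if j < s + 5 then x 0 \<union> y j else x 1 \<union> y (s + 4))" for j
  have xmono: "x 0 \<subseteq> x 1" and ymono: "\<And>i j. i \<le> j \<Longrightarrow> j < s + 5 \<Longrightarrow> y i \<subseteq> y j"
    using x(1) y(1) unfolding rank_enum_def by auto
  have cxy: "card (x i \<union> y j) = l + l' + (i + j) \<and> finite (x i \<union> y j)" if "i < 2" "j < s + 5" for i j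
  proof -
    have "x i \<subseteq> I" "y j \<subseteq> J" using XY.sub'(1)[of i] suby[OF that(2)] X(2) that by auto
    then have "x i \<inter> y j = {}" using assms(4) by auto
    moreover have "finite (x i)" "finite (y j)" "card (x i) = l + i" "card (y j) = l' + j"
      using x(1) y(1) that unfolding rank_enum_def by auto
    ultimately show ?thesis by (simp add: card_Un_disjoint)
  qed
  have v: "rank_enum v (l + l') (s + 6)"
    unfolding rank_enum_def
  proof (intro conjI allI impI)
    fix i assume "i < s + 6"
    then show "finite (v i)" "card (v i) = l + l' + i"
      using cxy[of 0 i] cxy[of 1 "s + 4"] by (auto simp: v_def)
  next
    fix i j assume "i \<le> j" "j < s + 6"
    then show "v i \<subseteq> v j" using xmono ymono[of i j] ymono[of i "s + 4"] by (auto simp: v_def)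
  qed simp
  have subv: "v ` {..<s + 6} \<subseteq> Pow (I \<union> J)"
  proof
    fix u assume "u \<in> v ` {..<s + 6}"
    then obtain j where "u = v j" by auto
    then show "u \<in> Pow (I \<union> J)" using subx suby[of j] suby[of "s + 4"] by (auto simp: v_def)
  qed
  have subz: "z ` {..<t + 5} \<subseteq> Pow K" using Z(1) z(2) by (simp add: linkless_chain_def)
  have Nv: "2 * (l + l') + (s + 6) = (N + N') + 1" using x(4) y(4) by simp
  \<comment> \<open>\<open>X\<close> is too short to span, so \<open>x 0\<close> and
    \<open>x 1\<close> are not linked. A link in \<open>v\<close> therefore keeps the row and ends
    at \<open>s + 4\<close>, one step before the top.\<close>
  have lv: "i = i' \<or> i = 0 \<and> i' = s + 4" if "i < s + 6" "i' < s + 6" "link F (v i) (v i')" for i i'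
  proof -
    define e where "e j = (if j < s + 5 then 0 else (1::nat))" for j
    define f where "f j = (if j < s + 5 then j else s + 4)" for j
    have vef: "v j = x (e j) \<union> y (f j)" for j by (simp add: v_def e_def f_def)
    have ef: "e j < 2" "f j < s + 5" for j by (auto simp: e_def f_def)
    have xs: "x (e j) \<subseteq> I" for j using XY.sub'(1)[of "e j"] ef[of j] X(2) by simp
    have "link F (x (e i)) (x (e i'))" "link F (y (f i)) (y (f i'))"
      using link_join[OF assms(1,2,4) that(3)[unfolded vef] xs xs suby[OF ef(2)] suby[OF ef(2)]] by auto
    then have "e i = e i'" "f i = f i' \<or> f i = 0 \<and> f i' = s + 4"
      using lx[OF ef(1) ef(1)] enum_link[OF Y(1) y(1,2) assms(2) ef(2) ef(2)] by (auto simp: add.commute)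
    then show ?thesis using that(1,2) by (auto simp: e_def f_def split: if_splits)
  qed
  have lz: "i = i' \<or> i = 0 \<and> i' = t + 4" if "i < t + 5" "i' < t + 5" "link F (z i) (z i')" for i i'
    using enum_link[OF Z(1) z(1,2) assms(3) that] by auto
  let ?R = "{3..<s + 6} \<times> {0..<t + 2}"
  have piece: "linkless_dec F (I \<union> J \<union> K) (N + N' + M) 1 (grid_set v z c)"
    if c: "c \<in> {thin0 s t, thin1 s t, thin2 s t}" for c
  proof -
    have g: "grid_chain (s + 6) (t + 5) c" "c \<noteq> {}"
      using c by (elim insertE emptyE; simp add: grid_chain_thin0 grid_chain_thin1 grid_chain_thin2)+
    then have b: "c \<subseteq> {..<s + 6} \<times> {..<t + 5}" by (simp add: grid_chain_def)
    then have "1 \<le> card c" using g(2) finite_subset[OF b] by (simp add: Suc_le_eq card_gt_0_iff)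
    then show ?thesis
    proof (intro linkless_dec_single linkless_grid_set[OF sIJ assms(3) K v z(1) subv subz Nv z(3) g(1)])
      fix i j i' j'
      assume p: "(i, j) \<in> c" "(i', j') \<in> c" "link F (v i) (v i')" "link F (z j) (z j')"
      then have "i = i' \<and> j = j'" using b by (intro thin_linkless[OF c p(1,2)] lv lz) auto
      then show "v i \<union> z j = v i' \<union> z j' \<or> v i \<union> z j = {} \<and> v i' \<union> z j' = I \<union> J \<union> K" by simp
    qed
  qed
  have rest: "linkless_dec F (I \<union> J \<union> K) (N + N' + M) 1 (grid_set v z ?R)"
  proof -
    \<comment> \<open>Three members are dropped at the bottom of \<open>v\<close> and three at the
      top of \<open>z\<close>, so the rank sums shift by 3 in opposite directions. Without index 0
      nothing in \<open>v\<close> is linked any more, and the ordinary join suffices.\<close>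
    have e: "N + N' + 3 = 2 * (l + l') + 3 + (s + 6) - 1" "M - 3 = 2 * lz + 0 + (t + 2) - 1"
      using Nv z(3) by simp_all
    have rv: "rank_chain (N + N' + 3) (v ` {3..<s + 6})" "card (v ` {3..<s + 6}) = s + 3"
      unfolding e(1) by (rule rank_chain_of_enum[OF v]; simp) (simp add: rank_chain_of_enum(2)[OF v])
    have rz: "rank_chain (M - 3) (z ` {0..<t + 2})" "card (z ` {0..<t + 2}) = t + 2"
      unfolding e(2) by (rule rank_chain_of_enum[OF z(1)]; simp) (simp add: rank_chain_of_enum(2)[OF z(1)])
    have "linkless_chain F (I \<union> J) (N + N' + 3) 3 (v ` {3..<s + 6})"
      unfolding linkless_chain_def
    proof (intro conjI ballI impI)
      show "v ` {3..<s + 6} \<subseteq> Pow (I \<union> J)" by (rule subset_trans[OF image_mono subv]) auto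
      fix u w assume "u \<in> v ` {3..<s + 6}" "w \<in> v ` {3..<s + 6}" "link F u w" "u \<noteq> w"
      obtain i where i: "u = v i" "3 \<le> i" "i < s + 6" using \<open>u \<in> _\<close> by auto
      obtain i' where "w = v i'" "i' < s + 6" using \<open>w \<in> _\<close> by auto
      with i have False using lv[of i i'] \<open>link F u w\<close> \<open>u \<noteq> w\<close> by auto
      then show "u = {}" "w = I \<union> J" by auto
    qed (use rv in auto)
    then have V: "linkless_dec F (I \<union> J) (N + N' + 3) 3 (v ` {3..<s + 6})" by (rule linkless_dec_single)
    have "linkless_chain F K (M - 3) 1 (z ` {0..<t + 2})"
      by (rule linkless_chain_subset[OF Z(1) _ rz(1)]) (use rz(2) z(2) in auto)
    then have W: "linkless_dec F K (M - 3) 1 (z ` {0..<t + 2})" by (rule linkless_dec_single)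
    have "{} \<notin> v ` {3..<s + 6}"
    proof
      assume "{} \<in> v ` {3..<s + 6}"
      then obtain i where i: "{} = v i" "i \<in> {3..<s + 6}" by (rule imageE)
      have "card (v i) = l + l' + i" using v i(2) unfolding rank_enum_def by simp
      moreover have "card (v i) = 0" by (subst i(1)[symmetric]) simp
      ultimately show False using i(2) by simp
    qed
    then have "\<not> spans F (I \<union> J) (v ` {3..<s + 6})" by (simp add: spans_def)
    then have "linkless_dec F (I \<union> J \<union> K) (N + N' + 3 + (M - 3)) 1 (v ` {3..<s + 6} \<otimes> z ` {0..<t + 2})"
      by (intro join_dec[OF sIJ assms(3) K V W]) auto
    moreover have "N + N' + 3 + (M - 3) = N + N' + M" using z(3) by simp
    ultimately show ?thesis unfolding grid_set_Times by simp
  qed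
  define V1 where "V1 = grid_set x y ({0} \<times> {..<s + 5} \<union> {(1, s + 4)})"
  define V2 where "V2 = grid_set x y ({1} \<times> {..<s + 4})"
  have c2: "{..<2::nat} \<times> {..<s + 5} = ({0} \<times> {..<s + 5} \<union> {(1, s + 4)}) \<union> {1} \<times> {..<s + 4}" by auto
  have XY: "X \<otimes> Y = V1 \<union> V2"
    using grid_set_Times[of x y "{..<2}" "{..<s + 5}"] x(2) y(2) unfolding V1_def V2_def c2 image_Un by simp
  have dis: "V1 \<inter> V2 = {}" unfolding V1_def V2_def
    by (rule grid_set_disjoint[OF x(1) y(1) assms(4)]) (use XY.sub X(2) s in auto)
  have "V1 = v ` {..<s + 6}"
  proof -
    have "{..<s + 6} = insert (s + 5) {..<s + 5}" by auto
    then show ?thesis unfolding V1_def image_Un by (auto simp: v_def image_iff)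
  qed
  then have "V1 \<otimes> Z = grid_set v z ({..<s + 6} \<times> {..<t + 5})" using z(2) by (simp add: grid_set_Times)
  also have "\<dots> = grid_set v z (thin0 s t) \<union> grid_set v z (thin1 s t) \<union> grid_set v z (thin2 s t) \<union> grid_set v z ?R"
    unfolding thin_cover image_Un ..
  finally have V1Z: "V1 \<otimes> Z = grid_set v z (thin0 s t) \<union> grid_set v z (thin1 s t) \<union> grid_set v z (thin2 s t) \<union> grid_set v z ?R" .
  have d: "grid_set v z A \<inter> grid_set v z B = {}"
    if "A \<subseteq> {..<s + 6} \<times> {..<t + 5}" "B \<subseteq> {..<s + 6} \<times> {..<t + 5}" "A \<inter> B = {}" for A B
    using grid_set_disjoint[OF v z(1) K subv subz that] .
  have b: "thin0 s t \<subseteq> {..<s + 6} \<times> {..<t + 5}" "thin1 s t \<subseteq> {..<s + 6} \<times> {..<t + 5}"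
    "thin2 s t \<subseteq> {..<s + 6} \<times> {..<t + 5}" "?R \<subseteq> {..<s + 6} \<times> {..<t + 5}"
    unfolding thin_cover by auto
  have "linkless_dec F (I \<union> J \<union> K) (N + N' + M) 1 (V1 \<otimes> Z)"
    unfolding V1Z
  proof (intro linkless_dec_Un rest piece)
    show "grid_set v z (thin0 s t) \<inter> grid_set v z (thin1 s t) = {}"
      by (rule d) (use b thin_disjoint in auto)
    show "(grid_set v z (thin0 s t) \<union> grid_set v z (thin1 s t)) \<inter> grid_set v z (thin2 s t) = {}"
      unfolding image_Un[symmetric] by (rule d) (use b thin_disjoint in auto)
    show "(grid_set v z (thin0 s t) \<union> grid_set v z (thin1 s t) \<union> grid_set v z (thin2 s t)) \<inter> grid_set v z ?R = {}"
      unfolding image_Un[symmetric] by (rule d) (use b thin_disjoint in auto)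
  qed auto
  moreover have "linkless_dec F (I \<union> J \<union> K) (N + N' + M) 1 (V2 \<otimes> Z)"
  proof -
    \<comment> \<open>The short chain is row 1 without its last point. It avoids the empty set and
      has \<open>s + 4\<close> members, so it may meet \<open>Z\<close> directly even if
      \<open>Z\<close> spans.\<close>
    have g: "grid_chain 2 (s + 5) ({1} \<times> {..<s + 4})"
    proof (rule grid_chainI)
      show "(\<lambda>(i, j). i + j) ` ({1} \<times> {..<s + 4}) = {1..s + 4}"
      proof (rule image_sum_eqI)
        fix q assume "1 \<le> q" "q \<le> s + 4"
        then have "(1, q - 1) \<in> {1::nat} \<times> {..<s + 4}" "1 + (q - 1) = q" by auto
        then show "\<exists>i j. (i, j) \<in> {1} \<times> {..<s + 4} \<and> i + j = q" by blast
      qed auto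
    qed auto
    have "linkless_chain F (I \<union> J) (N + N') 3 V2"
      unfolding V2_def by (rule XY.grid_linkless[unfolded X(2) s, OF g]) auto
    then have L: "linkless_dec F (I \<union> J) (N + N') 3 V2" by (rule linkless_dec_single)
    have "{} \<notin> V2"
    proof
      assume "{} \<in> V2"
      then obtain p where p: "{} = (\<lambda>(i, j). x i \<union> y j) p" "p \<in> {1} \<times> {..<s + 4}"
        unfolding V2_def by (rule imageE)
      then have "x 1 \<union> y (snd p) = {}" "snd p < s + 5" by (auto simp: case_prod_unfold)
      then show False using cxy[of 1 "snd p"] by simp
    qed
    then have "\<not> spans F (I \<union> J) V2" by (simp add: spans_def)
    then show ?thesis by (intro join_dec[OF sIJ assms(3) K L linkless_dec_single[OF Z(1)]]) auto
  qed
  moreover have "(V1 \<otimes> Z) \<inter> (V2 \<otimes> Z) = {}"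
  proof (rule join_disjoint[OF K _ _ _ _ dis])
    have "X \<otimes> Y \<subseteq> Pow (I \<union> J)"
      using X(1) Y(1) by (intro join_subset_Pow) (auto simp: linkless_chain_def)
    then show "V1 \<subseteq> Pow (I \<union> J)" "V2 \<subseteq> Pow (I \<union> J)" unfolding XY by auto
  qed (use Z(1) in \<open>auto simp: linkless_chain_def\<close>)
  ultimately show ?thesis unfolding XY join_Un by (rule linkless_dec_Un)
qed

section \<open>Four factors\<close>

text \<open>Intermediate products guarantee only nonempty chains, so the factors entering third and
  fourth must not span. Since \<open>U\<close> does not span, neither does
  \<open>P \<otimes> Q \<otimes> U\<close>, and \<open>V\<close> may have any length.\<close>

lemma join_dec4:
  assumes sp: "splits F I" "splits F J" "splits F K" "splits F L"
    and dis: "I \<inter> J = {}" "I \<inter> K = {}" "I \<inter> L = {}" "J \<inter> K = {}" "J \<inter> L = {}" "K \<inter> L = {}"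
    and P: "linkless_chain F I N1 k1 P" and Q: "linkless_chain F J N2 k2 Q"
    and U: "linkless_chain F K N3 k3 U" and V: "linkless_chain F L N4 k4 V"
    and c: "3 \<le> card P \<or> \<not> spans F J Q" "3 \<le> card Q \<or> \<not> spans F I P"
      "3 \<le> card U \<or> \<not> spans F J Q" "\<not> spans F K U" "\<not> spans F L V"
  shows "linkless_dec F (I \<union> J \<union> K \<union> L) (N1 + N2 + N3 + N4) 1 (P \<otimes> Q \<otimes> U \<otimes> V)"
proof -
  have dec: "linkless_dec F G n (card X) X" if "linkless_chain F G n k X" for G n k X
    using that by (intro linkless_dec_single) (simp add: linkless_chain_def)
  have sub: "P \<subseteq> Pow I" "Q \<subseteq> Pow J" "U \<subseteq> Pow K" using P Q U by (auto simp: linkless_chain_def)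
  have d: "(I \<union> J) \<inter> K = {}" "(I \<union> J \<union> K) \<inter> L = {}" using dis by auto
  note s2 = splits_Un[OF sp(1,2) dis(1)]
  note s3 = splits_Un[OF s2 sp(3) d(1)]
  have d2: "linkless_dec F (I \<union> J) (N1 + N2) 1 (P \<otimes> Q)"
    by (rule join_dec[OF sp(1,2) dis(1) dec[OF P] dec[OF Q] c(1,2)])
  have "3 \<le> card U \<or> \<not> spans F (I \<union> J) (P \<otimes> Q)"
    using spans_join(2)[OF sp(1,2) dis(1) sub(1,2)] c(3) by blast
  then have d3: "linkless_dec F (I \<union> J \<union> K) (N1 + N2 + N3) 1 (P \<otimes> Q \<otimes> U)"
    by (intro join_dec[OF s2 sp(3) d(1) d2 dec[OF U]]) (use c(4) in auto)
  have "\<not> spans F (I \<union> J \<union> K) (P \<otimes> Q \<otimes> U)"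
    using spans_join(2)[OF s2 sp(3) d(1) join_subset_Pow[OF sub(1,2)] sub(3)] c(4) by blast
  then show ?thesis
    by (intro join_dec[OF s3 sp(4) d(2) d3 dec[OF V]]) (use c(5) in auto)
qed

text \<open>With four long factors, both halves are cut at their corners until only products of two
  long pieces are left for \<open>join_dec\<close>. A fourth factor that does not span comes last;
  it has three members because the product of the other three may span.\<close>

lemma corner_dec4:
  assumes sp: "splits F I" "splits F J" "splits F K" "splits F L"
    and dis: "I \<inter> J = {}" "I \<inter> K = {}" "I \<inter> L = {}" "J \<inter> K = {}" "J \<inter> L = {}" "K \<inter> L = {}"
    and P: "linkless_chain F I N1 k1 P" "5 \<le> card P" and Q: "linkless_chain F J N2 k2 Q" "5 \<le> card Q"
    and U: "linkless_chain F K N3 k3 U" "5 \<le> card U" and V: "linkless_chain F L N4 k4 V"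
    and c: "5 \<le> card V \<or> 3 \<le> card V \<and> \<not> spans F L V"
  shows "linkless_dec F (I \<union> J \<union> K \<union> L) (N1 + N2 + N3 + N4) 1 (P \<otimes> Q \<otimes> U \<otimes> V)"
proof -
  have dec: "linkless_dec F G n (card X) X" if "linkless_chain F G n k X" for G n k X
    using that by (intro linkless_dec_single) (simp add: linkless_chain_def)
  have d: "(I \<union> J) \<inter> K = {}" "(I \<union> J \<union> K) \<inter> L = {}" "(I \<union> J) \<inter> (K \<union> L) = {}"
    "I \<inter> (K \<union> L) = {}" "J \<inter> (K \<union> L) = {}" "K \<inter> (I \<union> J) = {}" "L \<inter> (I \<union> J) = {}" using dis by auto
  note sIJ = splits_Un[OF sp(1,2) dis(1)] and sKL = splits_Un[OF sp(3,4) dis(6)]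
  note s3 = splits_Un[OF sIJ sp(3) d(1)]
  from c show ?thesis
  proof
    assume V5: "5 \<le> card V"
    \<comment> \<open>This decomposition serves the rectangle of \<open>P \<otimes> Q\<close>;
      against the long pieces, \<open>U \<otimes> V\<close> is cut at its own corners.\<close>
    have KL: "linkless_dec F (K \<union> L) (N3 + N4) 1 (U \<otimes> V)"
      by (rule join_dec[OF sp(3,4) dis(6) dec[OF U(1)] dec[OF V]]) (use U(2) V5 in auto)
    have "linkless_dec F (I \<union> J \<union> (K \<union> L)) (N1 + N2 + (N3 + N4)) 1 (P \<otimes> Q \<otimes> (U \<otimes> V))"
    proof (rule corner_join[OF sp(1,2) sKL dis(1) d(4,5) P Q KL])
      fix Z assume Z: "linkless_chain F (I \<union> J) (N1 + N2) 5 Z"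
      have "linkless_dec F (K \<union> L \<union> (I \<union> J)) (N3 + N4 + (N1 + N2)) 1 (U \<otimes> V \<otimes> Z)"
      proof (rule corner_join[OF sp(3,4) sIJ dis(6) d(6,7) U V V5 linkless_dec_single[OF Z]])
        fix Z' assume Z': "linkless_chain F (K \<union> L) (N3 + N4) 5 Z'"
        have "(K \<union> L) \<inter> (I \<union> J) = {}" using d(3) by auto
        then show "linkless_dec F (K \<union> L \<union> (I \<union> J)) (N3 + N4 + (N1 + N2)) 1 (Z' \<otimes> Z)"
          by (rule join_dec[OF sKL sIJ _ linkless_dec_single[OF Z'] linkless_dec_single[OF Z]]) auto
      qed
      then show "linkless_dec F (I \<union> J \<union> (K \<union> L)) (N1 + N2 + (N3 + N4)) 1 (Z \<otimes> (U \<otimes> V))"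
        by (simp only: join_commute[of Z] Un_commute[of "I \<union> J"] add.commute[of "N1 + N2"])
    qed
    then show ?thesis by (simp only: join_assoc Un_assoc add.assoc)
  next
    assume V3: "3 \<le> card V \<and> \<not> spans F L V"
    have "linkless_dec F (I \<union> J \<union> K) (N1 + N2 + N3) 1 (P \<otimes> Q \<otimes> U)"
    proof (rule corner_join[OF sp(1-3) dis(1,2,4) P Q dec[OF U(1)]])
      fix Z assume Z: "linkless_chain F (I \<union> J) (N1 + N2) 5 Z"
      show "linkless_dec F (I \<union> J \<union> K) (N1 + N2 + N3) 1 (Z \<otimes> U)"
        by (rule join_dec[OF sIJ sp(3) d(1) linkless_dec_single[OF Z] dec[OF U(1)]]) (use U(2) in auto)
    qed
    then show ?thesis
      by (intro join_dec[OF s3 sp(4) d(2) _ dec[OF V]]) (use V3 in auto)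
  qed
qed

text \<open>Of the pieces of \<open>Q \<otimes> U\<close> only \<open>Z0\<close> can contain the
  empty set, so only there \<open>thin_join\<close> is called for. The other pieces meet
  \<open>V\<close> first; the result does not span, and the two-element factor \<open>P\<close> can
  safely come last.\<close>

lemma thin_dec4:
  assumes sp: "splits F I" "splits F J" "splits F K" "splits F L"
    and dis: "I \<inter> J = {}" "I \<inter> K = {}" "I \<inter> L = {}" "J \<inter> K = {}" "J \<inter> L = {}" "K \<inter> L = {}"
    and P: "linkless_chain F I N1 k1 P" "card P = 2" and Q: "linkless_chain F J N2 k2 Q" "5 \<le> card Q"
    and U: "linkless_chain F K N3 k3 U" "5 \<le> card U" and V: "linkless_chain F L N4 k4 V" "5 \<le> card V"
  shows "linkless_dec F (I \<union> J \<union> K \<union> L) (N1 + N2 + N3 + N4) 1 (P \<otimes> Q \<otimes> U \<otimes> V)"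
proof -
  have dec: "linkless_dec F G n (card X) X" if "linkless_chain F G n k X" for G n k X
    using that by (intro linkless_dec_single) (simp add: linkless_chain_def)
  have d: "(J \<union> K) \<inter> L = {}" "(J \<union> K \<union> L) \<inter> I = {}" "I \<inter> (J \<union> K) = {}" "L \<inter> (J \<union> K) = {}"
    "(J \<union> K) \<inter> (I \<union> L) = {}"
    using dis by auto
  note sJK = splits_Un[OF sp(2,3) dis(4)]
  note s3 = splits_Un[OF sJK sp(4) d(1)]
  have nP: "\<not> spans F I P" using spans_card[OF P(1) sp(1)] P(2) by auto
  obtain Z0 Z1 R1 R2 where S: "Q \<otimes> U = Z0 \<union> Z1 \<union> R1 \<otimes> R2" "Z0 \<inter> Z1 = {}" "(Z0 \<union> Z1) \<inter> (R1 \<otimes> R2) = {}"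
    "linkless_chain F (J \<union> K) (N2 + N3) 5 Z0" "linkless_chain F (J \<union> K) (N2 + N3) 5 Z1" "{} \<notin> Z1"
    "linkless_chain F J (N2 + 2) 3 R1" "{} \<notin> R1" "linkless_chain F K (N3 - 2) 3 R2" "K \<notin> R2" "2 \<le> N3"
    using corner_pieces[OF sp(2,3) dis(4) Q(1) U(1) Q(2) U(2)] by metis
  let ?dec = "\<lambda>T. linkless_dec F (I \<union> J \<union> K \<union> L) (N1 + N2 + N3 + N4) 1 (T \<otimes> (P \<otimes> V))"
  have sub: "Z0 \<subseteq> Pow (J \<union> K)" "Z1 \<subseteq> Pow (J \<union> K)" "R1 \<otimes> R2 \<subseteq> Pow (J \<union> K)" "V \<subseteq> Pow L" "P \<otimes> V \<subseteq> Pow (I \<union> L)"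
    using S(4,5) join_subset_Pow[of R1 J R2 K] join_subset_Pow[of P I V L] S(7,9) V(1) P(1)
    by (simp_all add: linkless_chain_def)
  have "linkless_dec F (I \<union> L \<union> (J \<union> K)) (N1 + N4 + (N2 + N3)) 1 (P \<otimes> V \<otimes> Z0)"
    using S(4) by (intro thin_join[OF sp(1,4) sJK dis(3) d(3,4) P V S(4)]) (simp add: linkless_chain_def)
  then have d0: "?dec Z0" by (simp only: join_ac Un_ac add_ac)
  have with_P: "?dec T" if T: "linkless_dec F (J \<union> K \<union> L) (N2 + N3 + N4) 1 (T \<otimes> V)" "\<not> spans F (J \<union> K) T" "T \<subseteq> Pow (J \<union> K)" for T
  proof -
    have "\<not> spans F (J \<union> K \<union> L) (T \<otimes> V)" using spans_join(1)[OF sJK sp(4) d(1) T(3) sub(4)] T(2) by blast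
    then have "linkless_dec F (J \<union> K \<union> L \<union> I) (N2 + N3 + N4 + N1) 1 (T \<otimes> V \<otimes> P)"
      by (intro join_dec[OF s3 sp(1) d(2) T(1) dec[OF P(1)]]) (use nP in auto)
    then show ?thesis by (simp only: join_ac Un_ac add_ac)
  qed
  have d1: "?dec Z1"
  proof (rule with_P[OF _ _ sub(2)])
    show "linkless_dec F (J \<union> K \<union> L) (N2 + N3 + N4) 1 (Z1 \<otimes> V)"
      by (rule join_dec[OF sJK sp(4) d(1) linkless_dec_single[OF S(5)] dec[OF V(1)]]) (use V(2) in auto)
  qed (use S(6) in \<open>simp add: spans_def\<close>)
  have d2: "?dec (R1 \<otimes> R2)"
  proof (rule with_P[OF _ _ sub(3)])
    have e: "N2 + 2 + (N3 - 2) + N4 = N2 + N3 + N4" using S(11) by simp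
    show "linkless_dec F (J \<union> K \<union> L) (N2 + N3 + N4) 1 (R1 \<otimes> R2 \<otimes> V)"
      using rect_join[OF sp(2,3,4) dis(4-6) S(7-10) dec[OF V(1)]] unfolding e .
    show "\<not> spans F (J \<union> K) (R1 \<otimes> R2)"
      using S(8) by (auto simp: spans_def join_iff)
  qed
  have "(Z0 \<otimes> (P \<otimes> V)) \<inter> (Z1 \<otimes> (P \<otimes> V)) = {}" using join_disjoint[OF d(5) sub(1,2,5,5) S(2)] .
  moreover have "(Z0 \<otimes> (P \<otimes> V) \<union> Z1 \<otimes> (P \<otimes> V)) \<inter> (R1 \<otimes> R2 \<otimes> (P \<otimes> V)) = {}"
    using join_disjoint[OF d(5) _ sub(3,5,5) S(3)] sub(1,2) unfolding join_Un[symmetric] by simp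
  ultimately have "?dec (Q \<otimes> U)" unfolding S(1) join_Un using d0 d1 d2 by (intro linkless_dec_Un)
  then show ?thesis by (simp only: join_ac)
qed

text \<open>If \<open>B\<close>, \<open>C\<close>, \<open>D\<close> all have at least three members,
  the number of spanning factors decides: up to two can be handled by a suitable order in
  \<open>join_dec4\<close>, three or four call for \<open>corner_dec4\<close> or
  \<open>thin_dec4\<close>. If one of them is smaller, the conditions \<open>T\<close> leave only
  \<open>A\<close> and one other factor that can span, and an order for \<open>join_dec4\<close>
  exists again.\<close>

lemma cuboid_dec:
  assumes sp: "splits F I" "splits F J" "splits F K" "splits F L"
    and dis: "I \<inter> J = {}" "I \<inter> K = {}" "I \<inter> L = {}" "J \<inter> K = {}" "J \<inter> L = {}" "K \<inter> L = {}"
    and A: "linkless_chain F I N1 k1 A" and B: "linkless_chain F J N2 k2 B"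
    and C: "linkless_chain F K N3 k3 C" and D: "linkless_chain F L N4 k4 D"
    and c2: "card A = 2 \<or> 3 \<le> card A"
    and c5: "spans F I A \<Longrightarrow> 5 \<le> card A" "spans F J B \<Longrightarrow> 5 \<le> card B"
      "spans F K C \<Longrightarrow> 5 \<le> card C" "spans F L D \<Longrightarrow> 5 \<le> card D"
    and T: "spans F I A \<Longrightarrow> 3 \<le> card B \<and> 3 \<le> card C \<or> 3 \<le> card B \<and> 3 \<le> card D \<or> 3 \<le> card C \<and> 3 \<le> card D"
      "spans F J B \<Longrightarrow> 3 \<le> card D" "spans F K C \<Longrightarrow> 3 \<le> card B" "spans F L D \<Longrightarrow> 3 \<le> card C"
  shows "linkless_dec F (I \<union> J \<union> K \<union> L) (N1 + N2 + N3 + N4) 1 (A \<otimes> B \<otimes> C \<otimes> D)"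
proof -
  have dis': "J \<inter> I = {}" "K \<inter> I = {}" "L \<inter> I = {}" "K \<inter> J = {}" "L \<inter> J = {}" "L \<inter> K = {}"
    using dis by auto
  have eA: "\<not> spans F I A" if "card A = 2" using c5(1) that by auto
  note sims = join_ac Un_ac add_ac
  \<comment> \<open>Each name spells the order in which the factors are joined.\<close>
  have ACBD: ?thesis if "3 \<le> card A \<or> \<not> spans F K C" "3 \<le> card C \<or> \<not> spans F I A" "3 \<le> card B \<or> \<not> spans F K C" "\<not> spans F J B" "\<not> spans F L D"
    using join_dec4[OF sp(1,3,2,4) dis(2) dis(1) dis(3) dis'(4) dis(6) dis(5) A C B D that] by (simp only: sims)
  have CBAD: ?thesis if "3 \<le> card C \<or> \<not> spans F J B" "3 \<le> card B \<or> \<not> spans F K C" "3 \<le> card A \<or> \<not> spans F J B" "\<not> spans F I A" "\<not> spans F L D"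
    using join_dec4[OF sp(3,2,1,4) dis'(4) dis'(2) dis(6) dis'(1) dis(5) dis(3) C B A D that] by (simp only: sims)
  have ABDC: ?thesis if "3 \<le> card A \<or> \<not> spans F J B" "3 \<le> card B \<or> \<not> spans F I A" "3 \<le> card D \<or> \<not> spans F J B" "\<not> spans F L D" "\<not> spans F K C"
    using join_dec4[OF sp(1,2,4,3) dis(1) dis(3) dis(2) dis(5) dis(4) dis'(6) A B D C that] by (simp only: sims)
  have BDAC: ?thesis if "3 \<le> card B \<or> \<not> spans F L D" "3 \<le> card D \<or> \<not> spans F J B" "3 \<le> card A \<or> \<not> spans F L D" "\<not> spans F I A" "\<not> spans F K C"
    using join_dec4[OF sp(2,4,1,3) dis(5) dis'(1) dis(4) dis'(3) dis'(6) dis(2) B D A C that] by (simp only: sims)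
  have ADCB: ?thesis if "3 \<le> card A \<or> \<not> spans F L D" "3 \<le> card D \<or> \<not> spans F I A" "3 \<le> card C \<or> \<not> spans F L D" "\<not> spans F K C" "\<not> spans F J B"
    using join_dec4[OF sp(1,4,3,2) dis(3) dis(2) dis(1) dis'(6) dis'(5) dis'(4) A D C B that] by (simp only: sims)
  have DCAB: ?thesis if "3 \<le> card D \<or> \<not> spans F K C" "3 \<le> card C \<or> \<not> spans F L D" "3 \<le> card A \<or> \<not> spans F K C" "\<not> spans F I A" "\<not> spans F J B"
    using join_dec4[OF sp(4,3,1,2) dis'(6) dis'(3) dis'(5) dis'(2) dis'(4) dis(1) D C A B that] by (simp only: sims)
  have DCBA: ?thesis if "3 \<le> card D \<or> \<not> spans F K C" "3 \<le> card C \<or> \<not> spans F L D" "3 \<le> card B \<or> \<not> spans F K C" "\<not> spans F J B" "\<not> spans F I A"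
    using join_dec4[OF sp(4,3,2,1) dis'(6) dis'(5) dis'(3) dis'(4) dis'(2) dis'(1) D C B A that] by (simp only: sims)
  have BDCA: ?thesis if "3 \<le> card B \<or> \<not> spans F L D" "3 \<le> card D \<or> \<not> spans F J B" "3 \<le> card C \<or> \<not> spans F L D" "\<not> spans F K C" "\<not> spans F I A"
    using join_dec4[OF sp(2,4,3,1) dis(5) dis(4) dis'(1) dis'(6) dis'(3) dis'(2) B D C A that] by (simp only: sims)
  have CBDA: ?thesis if "3 \<le> card C \<or> \<not> spans F J B" "3 \<le> card B \<or> \<not> spans F K C" "3 \<le> card D \<or> \<not> spans F J B" "\<not> spans F L D" "\<not> spans F I A"
    using join_dec4[OF sp(3,2,4,1) dis'(4) dis(6) dis'(2) dis(5) dis'(1) dis'(3) C B D A that] by (simp only: sims)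
  show ?thesis
  proof (cases "3 \<le> card B \<and> 3 \<le> card C \<and> 3 \<le> card D")
    case all3: True
    show ?thesis
    proof (cases "spans F I A")
      case True
      then have A5: "5 \<le> card A" "3 \<le> card A" using c5(1) by auto
      consider "\<not> spans F J B" "\<not> spans F K C" | "\<not> spans F J B" "\<not> spans F L D" | "\<not> spans F K C" "\<not> spans F L D"
        | "spans F J B" "spans F K C" | "spans F J B" "spans F L D" | "spans F K C" "spans F L D" by blast
      then show ?thesis
      proof cases
        case 1 then show ?thesis using all3 A5 by (intro ADCB) auto
      next
        case 2 then show ?thesis using all3 A5 by (intro ACBD) auto
      next
        case 3 then show ?thesis using all3 A5 by (intro ABDC) auto
      next
        case 4
        then show ?thesis
          using c5(4) all3 by (intro corner_dec4[OF sp dis A A5(1) B c5(2) C c5(3) D]) auto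
      next
        case 5
        have "linkless_dec F (I \<union> J \<union> L \<union> K) (N1 + N2 + N4 + N3) 1 (A \<otimes> B \<otimes> D \<otimes> C)"
          by (rule corner_dec4[OF sp(1,2,4,3) dis(1) dis(3) dis(2) dis(5) dis(4) dis'(6) A A5(1) B c5(2) D c5(4) C])
            (use 5 c5(3) all3 in auto)
        then show ?thesis by (simp only: sims)
      next
        case 6
        have "linkless_dec F (I \<union> K \<union> L \<union> J) (N1 + N3 + N4 + N2) 1 (A \<otimes> C \<otimes> D \<otimes> B)"
          by (rule corner_dec4[OF sp(1,3,4,2) dis(2) dis(3) dis(1) dis(6) dis'(4) dis'(5) A A5(1) C c5(3) D c5(4) B])
            (use 6 c5(2) all3 in auto)
        then show ?thesis by (simp only: sims)
      qed
    next
      case nA: False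
      consider "\<not> spans F J B" | "\<not> spans F K C" | "\<not> spans F L D" | "spans F J B" "spans F K C" "spans F L D" by blast
      then show ?thesis
      proof cases
        case 1 then show ?thesis using all3 nA by (intro DCBA) auto
      next
        case 2 then show ?thesis using all3 nA by (intro BDCA) auto
      next
        case 3 then show ?thesis using all3 nA by (intro CBDA) auto
      next
        case 4
        show ?thesis
        proof (cases "card A = 2")
          case True
          then show ?thesis using 4 by (intro thin_dec4[OF sp dis A True B c5(2) C c5(3) D c5(4)])
        next
          case False
          then have "3 \<le> card A" using c2 by simp
          have "linkless_dec F (J \<union> K \<union> L \<union> I) (N2 + N3 + N4 + N1) 1 (B \<otimes> C \<otimes> D \<otimes> A)"
            by (rule corner_dec4[OF sp(2,3,4,1) dis(4) dis(5) dis'(1) dis(6) dis'(2) dis'(3) B c5(2) C c5(3) D c5(4) A])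
              (use 4 nA \<open>3 \<le> card A\<close> in auto)
          then show ?thesis by (simp only: sims)
        qed
      qed
    qed
  next
    case False
    then consider "\<not> 3 \<le> card D" | "\<not> 3 \<le> card C" | "\<not> 3 \<le> card B" by blast
    then show ?thesis
    proof cases
      case 1
      then have ns: "\<not> spans F L D" "\<not> spans F J B" using c5(4) T(2) by auto
      from c2 show ?thesis
      proof
        assume "card A = 2"
        with ns c2 eA T 1 show ?thesis by (intro CBAD) auto
      next
        assume "3 \<le> card A"
        with ns T 1 show ?thesis by (intro ACBD) auto
      qed
    next
      case 2
      then have ns: "\<not> spans F K C" "\<not> spans F L D" using c5(3) T(4) by auto
      from c2 show ?thesis
      proof
        assume "card A = 2"
        with ns c2 eA T 2 show ?thesis by (intro BDAC) auto
      next
        assume "3 \<le> card A"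
        with ns T 2 show ?thesis by (intro ABDC) auto
      qed
    next
      case 3
      then have ns: "\<not> spans F J B" "\<not> spans F K C" using c5(2) T(3) by auto
      from c2 show ?thesis
      proof
        assume "card A = 2"
        with ns c2 eA T 3 show ?thesis by (intro DCAB) auto
      next
        assume "3 \<le> card A"
        with ns T 3 show ?thesis by (intro ADCB) auto
      qed
    qed
  qed
qed

section \<open>Families of symmetric chain decompositions\<close>

text \<open>Almost orthogonality through shared comparable pairs instead of cardinalities: the form
  that can be compared with links, on a ground set that may be a translated block.\<close>

definition orthogonal_family :: "'a set \<Rightarrow> 'i set \<Rightarrow> ('i \<Rightarrow> 'a set set set) \<Rightarrow> bool" where
  "orthogonal_family I S \<F> \<longleftrightarrow>
     (\<forall>i\<in>S. partition_on (Pow I) (\<F> i) \<and> (\<forall>X\<in>\<F> i. rank_chain (card I) X)) \<and>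
     (\<forall>i\<in>S. \<forall>j\<in>S. i \<noteq> j \<longrightarrow> (\<forall>A\<in>\<F> i. \<forall>B\<in>\<F> j. \<forall>u\<in>A \<inter> B. \<forall>v\<in>A \<inter> B. u \<subset> v \<longrightarrow> u = {} \<and> v = I))"

lemma symmetric_chain_iff: "symmetric_chain n X \<longleftrightarrow> X \<subseteq> Pow {1..n} \<and> rank_chain n X"
proof -
  have "(\<exists>j. 2 * j \<le> n \<and> bij_betw card X {j..n - j}) \<longleftrightarrow> (\<exists>l h. l \<le> h \<and> l + h = n \<and> bij_betw card X {l..h})"
  proof
    assume "\<exists>j. 2 * j \<le> n \<and> bij_betw card X {j..n - j}"
    then obtain j where "2 * j \<le> n" "bij_betw card X {j..n - j}" by auto
    then show "\<exists>l h. l \<le> h \<and> l + h = n \<and> bij_betw card X {l..h}"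
      by (intro exI[of _ j] exI[of _ "n - j"]) simp
  next
    assume "\<exists>l h. l \<le> h \<and> l + h = n \<and> bij_betw card X {l..h}"
    then obtain l h where "l \<le> h" "l + h = n" "bij_betw card X {l..h}" by auto
    moreover from this have "n - l = h" by simp
    ultimately show "\<exists>j. 2 * j \<le> n \<and> bij_betw card X {j..n - j}" by (intro exI[of _ l]) simp
  qed
  then show ?thesis unfolding symmetric_chain_def rank_chain_def by blast
qed

text \<open>Chain members are comparable, so an intersection with at most one member is one without
  a proper pair. If both chains contain the empty set and \<open>I\<close>, any further shared
  member would form a forbidden pair with the empty set.\<close>

lemma almost_orthogonal_pair_iff:
  assumes fin: "finite I" and "I \<noteq> {}" and A: "A \<subseteq> Pow I" "rank_chain N A"
  shows "(if {{}, I} \<subseteq> A \<and> {{}, I} \<subseteq> B then card (A \<inter> B) = 2 else card (A \<inter> B) \<le> 1) \<longleftrightarrow>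
    (\<forall>u\<in>A \<inter> B. \<forall>v\<in>A \<inter> B. u \<subset> v \<longrightarrow> u = {} \<and> v = I)" (is "?L \<longleftrightarrow> ?R")
proof -
  have finAB: "finite (A \<inter> B)" using A(1) fin by (meson finite_Int finite_Pow_iff finite_subset)
  have two: "card {{}, I} = 2" using assms(2) by auto
  show ?thesis
  proof (cases "{{}, I} \<subseteq> A \<and> {{}, I} \<subseteq> B")
    case True
    then have sub: "{{}, I} \<subseteq> A \<inter> B" by auto
    have "?L \<longleftrightarrow> card (A \<inter> B) = 2" using True by simp
    also have "\<dots> \<longleftrightarrow> A \<inter> B = {{}, I}"
      using card_subset_eq[OF finAB sub] two by auto
    also have "\<dots> \<longleftrightarrow> ?R"
    proof
      assume "A \<inter> B = {{}, I}"
      then show ?R using assms(2) by auto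
    next
      assume R: ?R
      have "w \<in> {{}, I}" if "w \<in> A \<inter> B" for w
        using R[rule_format, of "{}" w] that sub by auto
      then show "A \<inter> B = {{}, I}" using sub by auto
    qed
    finally show ?thesis .
  next
    case False
    have "?L \<longleftrightarrow> card (A \<inter> B) \<le> 1" by (simp only: False if_False)
    also have "\<dots> \<longleftrightarrow> (\<forall>u\<in>A \<inter> B. \<forall>v\<in>A \<inter> B. u = v)"
      using card_le_Suc0_iff_eq[OF finAB] by simp
    also have "\<dots> \<longleftrightarrow> ?R"
    proof
      assume "\<forall>u\<in>A \<inter> B. \<forall>v\<in>A \<inter> B. u = v" then show ?R by blast
    next
      assume R: ?R
      have no: "\<not> u \<subset> v" if "u \<in> A \<inter> B" "v \<in> A \<inter> B" for u v
        using R[rule_format, OF that] that False by auto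
      have "u \<subseteq> v \<or> v \<subseteq> u" if "u \<in> A \<inter> B" "v \<in> A \<inter> B" for u v
        using A(2) that unfolding rank_chain_def by auto
      then show "\<forall>u\<in>A \<inter> B. \<forall>v\<in>A \<inter> B. u = v" using no by (metis psubsetI)
    qed
    finally show ?thesis .
  qed
qed

lemma orthogonal_family_iff:
  assumes "n \<ge> 1"
  shows "almost_orthogonal_scds n S \<F> \<longleftrightarrow> orthogonal_family {1..n} S \<F>"
proof -
  have scd: "scd n P \<longleftrightarrow> partition_on (Pow {1..n}) P \<and> (\<forall>X\<in>P. rank_chain (card {1..n}) X)" for P
  proof -
    have "symmetric_chain n X \<longleftrightarrow> rank_chain n X" if "partition_on (Pow {1..n}) P" "X \<in> P" for X
      using that symmetric_chain_iff[of n X] Union_upper[of X P] by (simp add: partition_on_def)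
    then show ?thesis unfolding scd_def by auto
  qed
  have ao: "almost_orthogonal n P Q \<longleftrightarrow>
      (\<forall>A\<in>P. \<forall>B\<in>Q. \<forall>u\<in>A \<inter> B. \<forall>v\<in>A \<inter> B. u \<subset> v \<longrightarrow> u = {} \<and> v = {1..n})" if "scd n P" for P Q
    unfolding almost_orthogonal_def
  proof (intro ball_cong refl)
    fix A B assume "A \<in> P"
    then have "A \<subseteq> Pow {1..n}" "rank_chain n A"
      using that by (simp_all add: scd_def symmetric_chain_iff)
    then show "(if {{}, {1..n}} \<subseteq> A \<and> {{}, {1..n}} \<subseteq> B then card (A \<inter> B) = 2 else card (A \<inter> B) \<le> 1) \<longleftrightarrow>
        (\<forall>u\<in>A \<inter> B. \<forall>v\<in>A \<inter> B. u \<subset> v \<longrightarrow> u = {} \<and> v = {1..n})"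
      using assms by (intro almost_orthogonal_pair_iff) auto
  qed
  show ?thesis
    unfolding almost_orthogonal_scds_def orthogonal_family_def scd[symmetric]
    by (intro conj_cong refl ball_cong imp_cong ao) simp
qed

lemma orthogonal_family_image:
  assumes F: "orthogonal_family I S \<F>" and inj: "inj_on f I" and fin: "finite I"
  shows "orthogonal_family (f ` I) S (\<lambda>i. (\<lambda>X. (`) f ` X) ` \<F> i)"
proof -
  have injP: "inj_on ((`) f) (Pow I)" using inj by (rule inj_on_image_Pow)
  have cI: "card (f ` I) = card I" using inj by (rule card_image)
  have sub: "X \<subseteq> Pow I" if "i \<in> S" "X \<in> \<F> i" for i X
    using F that Union_upper[of X "\<F> i"] by (simp add: orthogonal_family_def partition_on_def)
  have part: "partition_on (Pow (f ` I)) ((\<lambda>X. (`) f ` X) ` \<F> i)" if i: "i \<in> S" for i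
  proof -
    have p: "partition_on (Pow I) (\<F> i)" using F i by (simp add: orthogonal_family_def)
    have "{} \<notin> (\<lambda>X. (`) f ` X) ` \<F> i" using p by (auto simp: partition_on_def)
    moreover have "(`) f ` Pow I = Pow (f ` I)" by (rule image_Pow_surj) simp
    ultimately show ?thesis using partition_on_inj_image[OF p injP] by simp
  qed
  have rank: "rank_chain (card (f ` I)) ((`) f ` X)" if iX: "i \<in> S" "X \<in> \<F> i" for i X
  proof -
    have r: "rank_chain (card I) X" using F iX by (simp add: orthogonal_family_def)
    then obtain l h where lh: "l \<le> h" "l + h = card I" "bij_betw card X {l..h}"
      unfolding rank_chain_def by auto
    have c: "card (f ` u) = card u" if "u \<in> X" for u
      using sub[OF iX] that inj by (auto intro!: card_image inj_on_subset[OF inj])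
    have "bij_betw (card \<circ> (`) f) X {l..h}"
      using lh(3) c by (simp cong: bij_betw_cong)
    moreover have "bij_betw ((`) f) X ((`) f ` X)"
      using inj_on_subset[OF injP sub[OF iX]] by (rule inj_on_imp_bij_betw)
    ultimately have "bij_betw card ((`) f ` X) {l..h}" by (simp add: bij_betw_comp_iff)
    moreover have "u \<subseteq> v \<or> v \<subseteq> u" if uv: "u \<in> (`) f ` X" "v \<in> (`) f ` X" for u v
    proof -
      obtain u' v' where "u' \<in> X" "v' \<in> X" "u = f ` u'" "v = f ` v'" using uv by auto
      moreover have "u' \<subseteq> v' \<or> v' \<subseteq> u'" using r calculation unfolding rank_chain_def by blast
      ultimately show ?thesis by (auto intro: image_mono)
    qed
    ultimately show ?thesis unfolding rank_chain_def cI using lh(1,2) by blast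
  qed
  have orth: "u = {} \<and> v = f ` I"
    if ij: "i \<in> S" "j \<in> S" "i \<noteq> j" and A: "A \<in> \<F> i" and B: "B \<in> \<F> j"
      and u: "u \<in> ((`) f ` A) \<inter> ((`) f ` B)" and v: "v \<in> ((`) f ` A) \<inter> ((`) f ` B)" and "u \<subset> v" for i j A B u v
  proof -
    have e: "((`) f ` A) \<inter> ((`) f ` B) = (`) f ` (A \<inter> B)"
      using inj_on_image_Int[OF injP sub[OF ij(1) A] sub[OF ij(2) B]] ..
    obtain u' v' where uv: "u' \<in> A \<inter> B" "v' \<in> A \<inter> B" "u = f ` u'" "v = f ` v'"
      using u v unfolding e by auto
    have "u' \<subseteq> I" "v' \<subseteq> I" using sub[OF ij(1) A] uv by auto
    have "x \<in> v'" if "x \<in> u'" for x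
    proof -
      have "f x \<in> f ` v'" using that \<open>u \<subset> v\<close> uv(3,4) by auto
      then show ?thesis
        using inj_on_image_mem_iff[OF inj, of x v'] that \<open>u' \<subseteq> I\<close> \<open>v' \<subseteq> I\<close> by auto
    qed
    moreover have "u' \<noteq> v'" using \<open>u \<subset> v\<close> uv(3,4) by auto
    ultimately have "u' \<subset> v'" by blast
    moreover have "\<forall>u\<in>A \<inter> B. \<forall>v\<in>A \<inter> B. u \<subset> v \<longrightarrow> u = {} \<and> v = I"
      using F ij A B by (simp add: orthogonal_family_def)
    ultimately have "u' = {} \<and> v' = I" using uv(1,2) by blast
    then show ?thesis using uv(3,4) by simp
  qed
  show ?thesis unfolding orthogonal_family_def
  proof (intro conjI ballI impI)
    fix i j A B u v
    assume "i \<in> S" "j \<in> S" "i \<noteq> j" "A \<in> (\<lambda>X. (`) f ` X) ` \<F> i" "B \<in> (\<lambda>X. (`) f ` X) ` \<F> j"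
      and uv: "u \<in> A \<inter> B" "v \<in> A \<inter> B" "u \<subset> v"
    then obtain A' B' where "A' \<in> \<F> i" "B' \<in> \<F> j" "A = (`) f ` A'" "B = (`) f ` B'" by blast
    then show "u = {}" "v = f ` I" using orth[of i j A' B' u v] uv \<open>i \<in> S\<close> \<open>j \<in> S\<close> \<open>i \<noteq> j\<close> by simp_all
  qed (use part rank in auto)
qed

lemma rank_chain_card:
  assumes "rank_chain N X" shows "1 \<le> card X" "even (card X) \<longleftrightarrow> odd N"
proof -
  obtain l h where lh: "l \<le> h" "l + h = N" "bij_betw card X {l..h}" using assms by (auto simp: rank_chain_def)
  have c: "card X = h + 1 - l" using bij_betw_same_card[OF lh(3)] by simp
  show "1 \<le> card X" using c lh(1) by simp
  have "card X + 2 * l = N + 1" using c lh(1,2) by simp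
  then show "even (card X) \<longleftrightarrow> odd N" by presburger
qed

lemma rank_chain_full_card:
  assumes "rank_chain N X" "{} \<in> X" "I \<in> X" shows "card I + 1 \<le> card X"
proof -
  obtain l h where b: "bij_betw card X {l..h}" using assms(1) by (auto simp: rank_chain_def)
  have "0 \<in> {l..h}" using bspec[OF bij_betwE[OF b] assms(2)] by simp
  moreover have "card I \<in> {l..h}" using bspec[OF bij_betwE[OF b] assms(3)] .
  ultimately show ?thesis using bij_betw_same_card[OF b] by simp
qed

lemma rank_chain_mem:
  assumes "rank_chain N X" "u \<in> X" "finite u" "card u \<le> r" "card u + r \<le> N"
  obtains v where "v \<in> X" "card v = r" "u \<subseteq> v"
proof -
  obtain l h where lh: "l + h = N" "bij_betw card X {l..h}" using assms(1) by (auto simp: rank_chain_def)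
  have "l \<le> card u" using bspec[OF bij_betwE[OF lh(2)] assms(2)] by simp
  then have "r \<in> card ` X" using lh assms(4,5) by (auto simp: bij_betw_def)
  then obtain v where v: "v \<in> X" "card v = r" by auto
  have "u \<subseteq> v \<or> v \<subseteq> u" using assms(1,2) v(1) by (simp add: rank_chain_def)
  moreover have "u = v" if "v \<subseteq> u"
    using card_seteq[OF assms(3) that] assms(4) v(2) by simp
  ultimately show thesis using that v by blast
qed

definition good_family :: "'a set \<Rightarrow> 'i set \<Rightarrow> ('i \<Rightarrow> 'a set set set) \<Rightarrow> bool" where
  "good_family I S \<F> \<longleftrightarrow> orthogonal_family I S \<F> \<and> disjoint_family_on (\<lambda>i. {C \<in> \<F> i. card C = 1}) S"

lemma orthogonal_family_chain:
  assumes "orthogonal_family I S \<F>" "i \<in> S" "X \<in> \<F> i"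
  shows "X \<subseteq> Pow I" "rank_chain (card I) X"
  using assms Union_upper[of X "\<F> i"] by (simp_all add: orthogonal_family_def partition_on_def)

lemma orthogonal_family_cover:
  assumes "orthogonal_family I S \<F>" "i \<in> S" "u \<subseteq> I"
  obtains X where "X \<in> \<F> i" "u \<in> X"
proof -
  have "u \<in> \<Union>(\<F> i)" using assms by (simp add: orthogonal_family_def partition_on_def)
  then show thesis using that by blast
qed

lemma orthogonal_familyD:
  assumes "orthogonal_family I S \<F>" "i \<in> S" "j \<in> S" "i \<noteq> j" "A \<in> \<F> i" "B \<in> \<F> j"
    and "u \<in> A" "u \<in> B" "v \<in> A" "v \<in> B" "u \<subset> v"
  shows "u = {}" "v = I"
proof -
  have "\<forall>u\<in>A \<inter> B. \<forall>v\<in>A \<inter> B. u \<subset> v \<longrightarrow> u = {} \<and> v = I"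
    using assms(1-6) by (simp add: orthogonal_family_def)
  then show "u = {}" "v = I" using assms(7-11) by blast+
qed

section \<open>Lower bounds on the block sizes\<close>

lemma no_three_injection:
  assumes "k \<ge> 3" "finite M" "card M \<le> 2" "\<And>i. i \<in> {1..k::nat} \<Longrightarrow> b i \<in> M"
    and "\<And>i j. i \<in> {1..k} \<Longrightarrow> j \<in> {1..k} \<Longrightarrow> i \<noteq> j \<Longrightarrow> b i \<noteq> b j"
  shows False
proof -
  have "inj_on b {1..k}" using assms(5) unfolding inj_on_def by blast
  moreover have "b ` {1..k} \<subseteq> M" using assms(4) by auto
  ultimately have "card {1..k} \<le> card M" using assms(2) by (rule card_inj_on_le)
  then show False using assms(1,3) by simp
qed

text \<open>The chain through {a} contains some {a, b}, with only two choices for b. Three families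
  repeat a choice, and two of their chains then share a pair whose lower member is nonempty.\<close>

lemma orthogonal_family_card_ne_3:
  assumes F: "orthogonal_family I {1..k::nat} \<F>" and "k \<ge> 3"
  shows "card I \<noteq> 3"
proof
  assume c3: "card I = 3"
  then have fin: "finite I" using card.infinite by force
  obtain a where a: "a \<in> I" using c3 by fastforce
  have "\<exists>X b. X \<in> \<F> i \<and> {a} \<in> X \<and> {a, b} \<in> X \<and> b \<in> I - {a}" if i: "i \<in> {1..k}" for i
  proof -
    obtain X where X: "X \<in> \<F> i" "{a} \<in> X" using orthogonal_family_cover[OF F i, of "{a}"] a by auto
    note ch = orthogonal_family_chain[OF F i X(1)]
    obtain v where v: "v \<in> X" "card v = 2" "{a} \<subseteq> v"
      using rank_chain_mem[OF ch(2) X(2), of 2] c3 by auto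
    then obtain b where b: "v = {a, b}" "b \<noteq> a" by (auto simp: card_2_iff)
    then have "b \<in> I" using ch(1) v(1) by auto
    then show ?thesis using X v b by blast
  qed
  then obtain X b where Xb: "\<And>i. i \<in> {1..k} \<Longrightarrow> X i \<in> \<F> i \<and> {a} \<in> X i \<and> {a, b i} \<in> X i \<and> b i \<in> I - {a}"
    by metis
  show False
  proof (rule no_three_injection[OF assms(2), of "I - {a}" b])
    fix i j assume ij: "i \<in> {1..k}" "j \<in> {1..k}" "i \<noteq> j"
    show "b i \<noteq> b j"
    proof
      assume e: "b i = b j"
      have "{a} \<subset> {a, b i}" using Xb[OF ij(1)] by auto
      then show False
        using orthogonal_familyD(1)[OF F ij, of "X i" "X j" "{a}" "{a, b i}"] Xb[OF ij(1)] Xb[OF ij(2)] e by simp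
    qed
  qed (use Xb fin a c3 in auto)
qed

text \<open>The chain through the empty set uses up one of the two singletons, and the other one
  forms a one-element chain. Three families must repeat such a chain, against goodness.\<close>

lemma good_family_card_ne_2:
  assumes G: "good_family I {1..k::nat} \<F>" and "k \<ge> 3"
  shows "card I \<noteq> 2"
proof
  assume c2: "card I = 2"
  have F: "orthogonal_family I {1..k} \<F>" using G by (simp add: good_family_def)
  have fin: "finite I" using c2 card.infinite by force
  have "\<exists>c\<in>I. {{c}} \<in> \<F> i" if i: "i \<in> {1..k}" for i
  proof -
    obtain X where X: "X \<in> \<F> i" "{} \<in> X" using orthogonal_family_cover[OF F i, of "{}"] by auto
    note ch = orthogonal_family_chain[OF F i X(1)]
    obtain v where v: "v \<in> X" "card v = 1" using rank_chain_mem[OF ch(2) X(2), of 1] c2 by auto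
    obtain b where b: "v = {b}" using v(2) by (auto simp: card_1_singleton_iff)
    have "b \<in> I" using ch(1) v(1) b by auto
    then have "card (I - {b}) = 1" using c2 fin by simp
    then obtain c where c: "I - {b} = {c}" by (auto simp: card_1_singleton_iff)
    then have "c \<in> I" "c \<noteq> b" by auto
    then obtain Y where Y: "Y \<in> \<F> i" "{c} \<in> Y" using orthogonal_family_cover[OF F i, of "{c}"] by auto
    note ch' = orthogonal_family_chain[OF F i Y(1)]
    have "X \<noteq> Y"
    proof
      assume "X = Y"
      then have "{b} \<subseteq> {c} \<or> {c} \<subseteq> {b}" using ch(2) v(1) Y(2) unfolding b rank_chain_def by blast
      then show False using \<open>c \<noteq> b\<close> by auto
    qed
    moreover have "disjoint (\<F> i)" using F i by (simp add: orthogonal_family_def partition_on_def)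
    ultimately have "{} \<notin> Y" using X Y(1) disjointD by fastforce
    obtain l h where lh: "l \<le> h" "l + h = 2" "bij_betw card Y {l..h}" using ch'(2) c2 by (auto simp: rank_chain_def)
    have "l \<in> card ` Y" using lh(1,3) by (simp add: bij_betw_def)
    then obtain w where w: "w \<in> Y" "card w = l" by auto
    have "finite w" using w(1) ch'(1) fin finite_subset by blast
    moreover have "w \<noteq> {}" using w(1) \<open>{} \<notin> Y\<close> by auto
    ultimately have "l \<noteq> 0" using w(2) by auto
    then have "card Y = 1" using bij_betw_same_card[OF lh(3)] lh(1,2) by auto
    then have "Y = {{c}}" using Y(2) by (auto simp: card_1_singleton_iff)
    then show ?thesis using Y(1) \<open>c \<in> I\<close> by auto
  qed
  then obtain c where c: "\<And>i. i \<in> {1..k} \<Longrightarrow> c i \<in> I \<and> {{c i}} \<in> \<F> i" by metis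
  show False
  proof (rule no_three_injection[OF assms(2) fin, of c])
    fix i j assume ij: "i \<in> {1..k}" "j \<in> {1..k}" "i \<noteq> j"
    then have "{C \<in> \<F> i. card C = 1} \<inter> {C \<in> \<F> j. card C = 1} = {}"
      using G by (simp add: good_family_def disjoint_family_on_def)
    moreover have "{{c i}} \<in> {C \<in> \<F> i. card C = 1}" "{{c j}} \<in> {C \<in> \<F> j. card C = 1}"
      using c[OF ij(1)] c[OF ij(2)] by simp_all
    ultimately show "c i \<noteq> c j" by auto
  qed (use c c2 in auto)
qed

section \<open>Flags and the product of four families\<close>

definition full :: "'a set \<Rightarrow> 'a set set \<Rightarrow> bool" where
  "full I X \<longleftrightarrow> {} \<in> X \<and> I \<in> X"

text \<open>
  If \<open>B\<close>, \<open>C\<close>, \<open>D\<close> all have at least three elements, every full factor is flagged. If exactly one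
  of them is a singleton, then the full ones among \<open>A\<close> and the successor of the singleton factor in
  the cyclic order \<open>J, L, K\<close> are flagged. With this choice two cuboids without a common singleton
  factor cover each other's unflagged pairs.
\<close>

definition flags :: "'a set \<Rightarrow> 'a set \<Rightarrow> 'a set \<Rightarrow> 'a set \<Rightarrow>
    'a set set \<Rightarrow> 'a set set \<Rightarrow> 'a set set \<Rightarrow> 'a set set \<Rightarrow> 'a set set" where
  "flags I J K L A B C D = {H.
     H = I \<and> full I A \<and> (3 \<le> card B \<and> 3 \<le> card C \<or> 3 \<le> card B \<and> 3 \<le> card D \<or> 3 \<le> card C \<and> 3 \<le> card D) \<or>
     H = J \<and> full J B \<and> 3 \<le> card D \<or> H = K \<and> full K C \<and> 3 \<le> card B \<or> H = L \<and> full L D \<and> 3 \<le> card C}"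

text \<open>A block contained in \<open>I\<close> and different from it would be disjoint from it,
  hence empty. So \<open>I\<close> itself is the only block that can be switched.\<close>

lemma block_linkless:
  assumes F: "\<And>H. H \<in> F \<Longrightarrow> H = I \<or> H \<inter> I = {} \<and> H \<noteq> {}"
    and "link F u v" "u \<subseteq> I" "v \<subseteq> I" "u \<noteq> v"
  shows "u = {} \<and> v = I"
proof -
  obtain S where S: "S \<subseteq> F" "u \<inter> \<Union>S = {}" "v = u \<union> \<Union>S" using assms(2) by (auto simp: link_def)
  have "H = I" if H: "H \<in> S" for H
  proof -
    have "H \<subseteq> I" using S(3) assms(4) H by auto
    then show ?thesis using F[of H] S(1) H by auto
  qed
  moreover have "S \<noteq> {}" using S(3) assms(5) by auto
  ultimately have "\<Union>S = I" by auto
  then show ?thesis using S(2,3) assms(3) by auto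
qed

lemma block_spans:
  assumes F: "\<And>H. H \<in> F \<Longrightarrow> H = I \<or> H \<inter> I = {} \<and> H \<noteq> {}" and "I \<noteq> {}" "spans F I X"
  shows "I \<in> F"
proof -
  obtain S where S: "S \<subseteq> F" "\<Union>S = I" using assms(3) by (auto simp: spans_def)
  then obtain H where H: "H \<in> S" using assms(2) by auto
  then have "H \<subseteq> I" using S(2) by auto
  then have "H = I" using F[of H] S(1) H by auto
  then show ?thesis using H S(1) by auto
qed

locale four_blocks =
  fixes I J K L :: "'a set"
  assumes fin: "finite I" "finite J" "finite K" "finite L"
    and two: "2 \<le> card I" "2 \<le> card J" "2 \<le> card K" "2 \<le> card L"
    and dis: "I \<inter> J = {}" "I \<inter> K = {}" "I \<inter> L = {}" "J \<inter> K = {}" "J \<inter> L = {}" "K \<inter> L = {}"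
begin

lemma nonempty: "I \<noteq> {}" "J \<noteq> {}" "K \<noteq> {}" "L \<noteq> {}"
  using two by auto

lemma distinct_blocks: "I \<noteq> J" "I \<noteq> K" "I \<noteq> L" "J \<noteq> K" "J \<noteq> L" "K \<noteq> L"
  using dis nonempty by auto

lemma flag_blocks:
  assumes "H \<in> flags I J K L A B C D" "M \<in> {I, J, K, L}"
  shows "H = M \<or> H \<inter> M = {} \<and> H \<noteq> {}"
proof -
  have "H \<in> {I, J, K, L}" using assms(1) by (auto simp: flags_def)
  then show ?thesis using assms(2) dis nonempty by (elim insertE emptyE) (simp_all add: Int_commute)
qed

lemma splits_flags: 
  assumes "M \<in> {I, J, K, L}" shows "splits (flags I J K L A B C D) M"
proof -
  have "finite M" "2 \<le> card M" using assms fin two by auto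
  then show ?thesis using flag_blocks[OF _ assms] unfolding splits_def by blast
qed

lemma mem_flags:
  "I \<in> flags I J K L A B C D \<longleftrightarrow> full I A \<and> (3 \<le> card B \<and> 3 \<le> card C \<or> 3 \<le> card B \<and> 3 \<le> card D \<or> 3 \<le> card C \<and> 3 \<le> card D)"
  "J \<in> flags I J K L A B C D \<longleftrightarrow> full J B \<and> 3 \<le> card D"
  "K \<in> flags I J K L A B C D \<longleftrightarrow> full K C \<and> 3 \<le> card B"
  "L \<in> flags I J K L A B C D \<longleftrightarrow> full L D \<and> 3 \<le> card C"
  using distinct_blocks by (simp_all add: flags_def)

text \<open>Within a single block no link but the exempted one exists, so all four factors are
  linkless from the start. Spanning forces the block to be flagged, and the size conditions in
  \<open>flags\<close> are exactly those that \<open>cuboid_dec\<close> asks of spanning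
  factors.\<close>

lemma flags_dec:
  assumes A: "A \<subseteq> Pow I" "rank_chain N1 A" and B: "B \<subseteq> Pow J" "rank_chain N2 B"
    and C: "C \<subseteq> Pow K" "rank_chain N3 C" and D: "D \<subseteq> Pow L" "rank_chain N4 D"
    and "card A = 2 \<or> 3 \<le> card A"
    and five: "full I A \<Longrightarrow> 5 \<le> card A" "full J B \<Longrightarrow> 5 \<le> card B" "full K C \<Longrightarrow> 5 \<le> card C" "full L D \<Longrightarrow> 5 \<le> card D"
  shows "linkless_dec (flags I J K L A B C D) (I \<union> J \<union> K \<union> L) (N1 + N2 + N3 + N4) 1 (A \<otimes> B \<otimes> C \<otimes> D)"
proof -
  let ?F = "flags I J K L A B C D"
  have lc: "linkless_chain ?F M N 0 X" if "M \<in> {I, J, K, L}" "X \<subseteq> Pow M" "rank_chain N X" for M N X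
    unfolding linkless_chain_def
  proof (intro conjI ballI impI)
    fix u v assume "u \<in> X" "v \<in> X" "link ?F u v" "u \<noteq> v"
    then have "u = {} \<and> v = M" using that(2) by (intro block_linkless[OF flag_blocks[OF _ that(1)]]) auto
    then show "u = {}" "v = M" by auto
  qed (use that in auto)
  have sp: "M \<in> ?F" if "M \<in> {I, J, K, L}" "spans ?F M X" for M X
    by (rule block_spans[OF flag_blocks[OF _ that(1)] _ that(2)]) (use that(1) nonempty in auto)
  have sI: "I \<in> ?F" if "spans ?F I A" by (rule sp[OF _ that]) simp
  have sJ: "J \<in> ?F" if "spans ?F J B" by (rule sp[OF _ that]) simp
  have sK: "K \<in> ?F" if "spans ?F K C" by (rule sp[OF _ that]) simp
  have sL: "L \<in> ?F" if "spans ?F L D" by (rule sp[OF _ that]) simp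
  show ?thesis
  proof (rule cuboid_dec[OF splits_flags splits_flags splits_flags splits_flags dis
        lc[OF _ A] lc[OF _ B] lc[OF _ C] lc[OF _ D] assms(9)])
    show "5 \<le> card A" if "spans ?F I A" using sI[OF that] five(1) unfolding mem_flags by blast
    show "5 \<le> card B" if "spans ?F J B" using sJ[OF that] five(2) unfolding mem_flags by blast
    show "5 \<le> card C" if "spans ?F K C" using sK[OF that] five(3) unfolding mem_flags by blast
    show "5 \<le> card D" if "spans ?F L D" using sL[OF that] five(4) unfolding mem_flags by blast
    show "3 \<le> card B \<and> 3 \<le> card C \<or> 3 \<le> card B \<and> 3 \<le> card D \<or> 3 \<le> card C \<and> 3 \<le> card D" if "spans ?F I A"
      using sI[OF that] unfolding mem_flags by blast
    show "3 \<le> card D" if "spans ?F J B" using sJ[OF that] unfolding mem_flags by blast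
    show "3 \<le> card B" if "spans ?F K C" using sK[OF that] unfolding mem_flags by blast
    show "3 \<le> card C" if "spans ?F L D" using sL[OF that] unfolding mem_flags by blast
  qed auto
qed

lemma mem_cuboid:
  assumes "u \<in> A \<otimes> B \<otimes> C \<otimes> D" "A \<subseteq> Pow I" "B \<subseteq> Pow J" "C \<subseteq> Pow K" "D \<subseteq> Pow L"
  shows "u \<inter> I \<in> A" "u \<inter> J \<in> B" "u \<inter> K \<in> C" "u \<inter> L \<in> D" "u \<subseteq> I \<union> J \<union> K \<union> L"
proof -
  obtain a b c d where u: "u = a \<union> b \<union> c \<union> d" and m: "a \<in> A" "b \<in> B" "c \<in> C" "d \<in> D"
    using assms(1) unfolding join_def by auto
  have s: "a \<subseteq> I" "b \<subseteq> J" "c \<subseteq> K" "d \<subseteq> L" using m assms(2-5) by auto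
  have "u \<inter> I = a" "u \<inter> J = b" "u \<inter> K = c" "u \<inter> L = d" unfolding u using s dis by auto
  then show "u \<inter> I \<in> A" "u \<inter> J \<in> B" "u \<inter> K \<in> C" "u \<inter> L \<in> D" using m by auto
  show "u \<subseteq> I \<union> J \<union> K \<union> L" unfolding u using s by auto
qed

text \<open>Were all differing blocks flagged, switching them would be a link from \<open>u\<close>
  to \<open>v\<close> inside \<open>X\<close>. This is the bridge from almost orthogonal factors,
  which supply \<open>diff\<close>, to linkless chains.\<close>

lemma unflagged_difference:
  assumes F: "F = flags I J K L A B C D" and X: "linkless_chain F (I \<union> J \<union> K \<union> L) N k X"
    and uv: "u \<in> X" "v \<in> X" "u \<subset> v" "\<not> (u = {} \<and> v = I \<union> J \<union> K \<union> L)"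
    and diff: "\<And>M. M \<in> {I, J, K, L} \<Longrightarrow> u \<inter> M = v \<inter> M \<or> u \<inter> M = {} \<and> v \<inter> M = M"
  shows "\<exists>M\<in>{I, J, K, L}. u \<inter> M \<noteq> v \<inter> M \<and> M \<notin> F"
proof (rule ccontr)
  assume "\<not> ?thesis"
  then have flagged: "M \<in> F" if "M \<in> {I, J, K, L}" "u \<inter> M \<noteq> v \<inter> M" for M using that by blast
  define S where "S = {M \<in> {I, J, K, L}. u \<inter> M \<noteq> v \<inter> M}"
  have SF: "S \<subseteq> F" using flagged by (auto simp: S_def)
  have S: "u \<inter> M = {}" "M \<subseteq> v" if "M \<in> S" for M
    using diff[of M] that by (auto simp: S_def)
  have sub: "v \<subseteq> I \<union> J \<union> K \<union> L" using X uv(2) by (auto simp: linkless_chain_def)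
  have "z \<in> u \<union> \<Union>S" if z: "z \<in> v" for z
  proof -
    obtain M where M: "M \<in> {I, J, K, L}" "z \<in> M" using sub z by auto
    show ?thesis
    proof (cases "M \<in> S")
      case True then show ?thesis using M(2) by auto
    next
      case False
      then have "u \<inter> M = v \<inter> M" using M(1) unfolding S_def by blast
      then show ?thesis using z M(2) by auto
    qed
  qed
  moreover have "u \<union> \<Union>S \<subseteq> v" using uv(3) S(2) by auto
  ultimately have "v = u \<union> \<Union>S" by auto
  moreover have "u \<inter> \<Union>S = {}" using S(1) by auto
  ultimately have "link F u v" using SF unfolding link_def by blast
  then show False using X uv unfolding linkless_chain_def by blast
qed

lemma Pow_join: "Pow I' \<otimes> Pow J' = Pow (I' \<union> J')"
proof (intro equalityI subsetI)
  fix w assume "w \<in> Pow (I' \<union> J')"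
  then have "w = (w \<inter> I') \<union> (w - I')" "w \<inter> I' \<in> Pow I'" "w - I' \<in> Pow J'" by auto
  then show "w \<in> Pow I' \<otimes> Pow J'" unfolding join_iff by blast
qed (auto simp: join_def)

lemma cuboid_partition:
  assumes "partition_on (Pow I) \<A>" "partition_on (Pow J) \<B>" "partition_on (Pow K) \<C>" "partition_on (Pow L) \<D>"
  shows "partition_on (Pow (I \<union> J \<union> K \<union> L))
    ((\<lambda>(A, B, C, D). A \<otimes> B \<otimes> C \<otimes> D) ` (\<A> \<times> \<B> \<times> \<C> \<times> \<D>))"
proof -
  have d: "(I \<union> J) \<inter> K = {}" "(I \<union> J \<union> K) \<inter> L = {}" using dis by auto
  have "partition_on (Pow (I \<union> J)) ((\<lambda>(X, Y). X \<otimes> Y) ` (\<A> \<times> \<B>))"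
    using partition_on_join[OF assms(1) _ assms(2) _ dis(1)] by (simp add: Pow_join)
  from partition_on_join[OF this _ assms(3) _ d(1)]
  have "partition_on (Pow (I \<union> J \<union> K)) ((\<lambda>(X, Y). X \<otimes> Y) ` ((\<lambda>(X, Y). X \<otimes> Y) ` (\<A> \<times> \<B>) \<times> \<C>))"
    by (simp add: Pow_join)
  from partition_on_join[OF this _ assms(4) _ d(2)]
  have p: "partition_on (Pow (I \<union> J \<union> K \<union> L))
      ((\<lambda>(X, Y). X \<otimes> Y) ` ((\<lambda>(X, Y). X \<otimes> Y) ` ((\<lambda>(X, Y). X \<otimes> Y) ` (\<A> \<times> \<B>) \<times> \<C>) \<times> \<D>))"
    by (simp add: Pow_join)
  have "(\<lambda>(X, Y). X \<otimes> Y) ` ((\<lambda>(X, Y). X \<otimes> Y) ` ((\<lambda>(X, Y). X \<otimes> Y) ` (\<A> \<times> \<B>) \<times> \<C>) \<times> \<D>) =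
      (\<lambda>(A, B, C, D). A \<otimes> B \<otimes> C \<otimes> D) ` (\<A> \<times> \<B> \<times> \<C> \<times> \<D>)"
    by (auto simp: image_iff Bex_def)
  with p show ?thesis by simp
qed

theorem product_family:
  assumes odd: "odd (card I)" and even: "even (card J)" "even (card K)" "even (card L)" and k: "3 \<le> (k::nat)"
    and F: "orthogonal_family I {1..k} \<F>" and G: "good_family J {1..k} \<G>"
    and H: "good_family K {1..k} \<H>" and K: "good_family L {1..k} \<K>"
  obtains \<D> where "orthogonal_family (I \<union> J \<union> K \<union> L) {1..k} \<D>"
    and "\<And>i X. i \<in> {1..k} \<Longrightarrow> X \<in> \<D> i \<Longrightarrow> \<exists>A\<in>\<F> i. \<exists>B\<in>\<G> i. \<exists>C\<in>\<H> i. \<exists>D\<in>\<K> i. X \<subseteq> A \<otimes> B \<otimes> C \<otimes> D"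
proof -
  let ?S = "{1..k}" and ?U = "I \<union> J \<union> K \<union> L"
  have oG: "orthogonal_family J ?S \<G>" and oH: "orthogonal_family K ?S \<H>" and oK: "orthogonal_family L ?S \<K>"
    using G H K by (simp_all add: good_family_def)
  note fam = orthogonal_family_chain[OF F] orthogonal_family_chain[OF oG] orthogonal_family_chain[OF oH] orthogonal_family_chain[OF oK]
  have four: "4 \<le> card I" "4 \<le> card J" "4 \<le> card K" "4 \<le> card L"
  proof -
    have ge4: "4 \<le> n" if "2 \<le> n" "n \<noteq> (if even n then 2 else 3)" for n :: nat
    proof (rule ccontr)
      assume "\<not> 4 \<le> n"
      then have "n = 2 \<or> n = 3" using that(1) by linarith
      then show False using that(2) by auto
    qed
    show "4 \<le> card I" using ge4[OF two(1)] orthogonal_family_card_ne_3[OF F k] odd by simp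
    show "4 \<le> card J" using ge4[OF two(2)] good_family_card_ne_2[OF G k] even(1) by simp
    show "4 \<le> card K" using ge4[OF two(3)] good_family_card_ne_2[OF H k] even(2) by simp
    show "4 \<le> card L" using ge4[OF two(4)] good_family_card_ne_2[OF K k] even(3) by simp
  qed
  have N: "card ?U = card I + card J + card K + card L"
    using fin dis by (simp add: card_Un_disjoint Int_Un_distrib2)
  \<comment> \<open>The factors are quantified chain by chain, so that \<open>E\<close> can be
    chosen per cuboid without recovering the factors from the set \<open>P\<close>.\<close>
  define good where "good i P E \<longleftrightarrow> partition_on P E \<and> (\<forall>X\<in>E. \<exists>A\<in>\<F> i. \<exists>B\<in>\<G> i. \<exists>C\<in>\<H> i. \<exists>D\<in>\<K> i.
      X \<subseteq> A \<otimes> B \<otimes> C \<otimes> D \<and> linkless_chain (flags I J K L A B C D) ?U (card ?U) 1 X)" for i P E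
  define cuboids where "cuboids i = (\<lambda>(A, B, C, D). A \<otimes> B \<otimes> C \<otimes> D) ` (\<F> i \<times> \<G> i \<times> \<H> i \<times> \<K> i)" for i
  have "\<exists>E. good i P E" if i: "i \<in> ?S" and P: "P \<in> cuboids i" for i P
  proof -
    obtain A B C D where m: "A \<in> \<F> i" "B \<in> \<G> i" "C \<in> \<H> i" "D \<in> \<K> i" and P: "P = A \<otimes> B \<otimes> C \<otimes> D"
      using P by (auto simp: cuboids_def)
    note ch = fam(1,2)[OF i m(1)] fam(3,4)[OF i m(2)] fam(5,6)[OF i m(3)] fam(7,8)[OF i m(4)]
    \<comment> \<open>Chains over a block of odd size have even cardinality, so \<open>A\<close> is
      never a one-element chain.\<close>
    have "card A = 2 \<or> 3 \<le> card A" 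
    proof -
      have "1 \<le> card A" "even (card A)" using rank_chain_card[OF ch(2)] odd by simp_all
      then show ?thesis by (cases "card A = 1") auto
    qed
    then have "linkless_dec (flags I J K L A B C D) ?U (card ?U) 1 P" unfolding P N
      using four rank_chain_full_card[OF ch(2), of I] rank_chain_full_card[OF ch(4), of J]
        rank_chain_full_card[OF ch(6), of K] rank_chain_full_card[OF ch(8), of L]
      by (intro flags_dec[OF ch]) (auto simp: full_def)
    then obtain E where E: "partition_on P E" "\<forall>X\<in>E. linkless_chain (flags I J K L A B C D) ?U (card ?U) 1 X"
      by (auto simp: linkless_dec_def)
    have sub: "X \<subseteq> P" if "X \<in> E" for X using E(1) that Union_upper[of X E] by (simp add: partition_on_def)
    have "\<exists>A\<in>\<F> i. \<exists>B\<in>\<G> i. \<exists>C\<in>\<H> i. \<exists>D\<in>\<K> i.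
        X \<subseteq> A \<otimes> B \<otimes> C \<otimes> D \<and> linkless_chain (flags I J K L A B C D) ?U (card ?U) 1 X" if "X \<in> E" for X
      using m E(2) that sub[OF that, unfolded P] by (intro bexI conjI) simp_all
    then have "good i P E" unfolding good_def using E(1) by simp
    then show ?thesis by blast
  qed
  then obtain E where E: "\<And>i P. i \<in> ?S \<Longrightarrow> P \<in> cuboids i \<Longrightarrow> good i P (E i P)" by metis
  define \<D> where "\<D> i = (\<Union>P\<in>cuboids i. E i P)" for i
  have chain: "\<exists>A\<in>\<F> i. \<exists>B\<in>\<G> i. \<exists>C\<in>\<H> i. \<exists>D\<in>\<K> i.
      X \<subseteq> A \<otimes> B \<otimes> C \<otimes> D \<and> linkless_chain (flags I J K L A B C D) ?U (card ?U) 1 X" if "i \<in> ?S" "X \<in> \<D> i" for i X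
  proof -
    obtain P where "P \<in> cuboids i" "X \<in> E i P" using \<open>X \<in> \<D> i\<close> by (auto simp: \<D>_def)
    then show ?thesis using E[OF \<open>i \<in> ?S\<close>, of P] by (simp add: good_def)
  qed
  have part: "partition_on (Pow ?U) (\<D> i)" if i: "i \<in> ?S" for i
  proof -
    have p: "partition_on (Pow ?U) (cuboids i)" unfolding cuboids_def
      using F oG oH oK i by (intro cuboid_partition) (simp_all add: orthogonal_family_def)
    have "partition_on (\<Union>(cuboids i)) (\<D> i)" unfolding \<D>_def
    proof (rule partition_on_UN)
      show "P \<inter> Q = {}" if "P \<in> cuboids i" "Q \<in> cuboids i" "P \<noteq> Q" for P Q
        using disjointD[OF partition_onD2[OF p] that] .
      show "partition_on P (E i P)" if "P \<in> cuboids i" for P using E[OF i that] by (simp add: good_def)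
    qed
    then show ?thesis using partition_onD1[OF p] by simp
  qed
  have orth: "u = {} \<and> v = ?U" if ij: "i \<in> ?S" "j \<in> ?S" "i \<noteq> j" and X: "X \<in> \<D> i" and Y: "Y \<in> \<D> j"
    and u: "u \<in> X" "u \<in> Y" and v: "v \<in> X" "v \<in> Y" and "u \<subset> v" for i j X Y u v
  proof (rule ccontr)
    assume neq: "\<not> (u = {} \<and> v = ?U)"
    obtain A B C D where m: "A \<in> \<F> i" "B \<in> \<G> i" "C \<in> \<H> i" "D \<in> \<K> i" and
      X': "X \<subseteq> A \<otimes> B \<otimes> C \<otimes> D" "linkless_chain (flags I J K L A B C D) ?U (card ?U) 1 X"
      using chain[OF ij(1) X] by blast
    obtain A' B' C' D' where m': "A' \<in> \<F> j" "B' \<in> \<G> j" "C' \<in> \<H> j" "D' \<in> \<K> j" and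
      Y': "Y \<subseteq> A' \<otimes> B' \<otimes> C' \<otimes> D'" "linkless_chain (flags I J K L A' B' C' D') ?U (card ?U) 1 Y"
      using chain[OF ij(2) Y] by blast
    note ch = fam(1,2)[OF ij(1) m(1)] fam(3,4)[OF ij(1) m(2)] fam(5,6)[OF ij(1) m(3)] fam(7,8)[OF ij(1) m(4)]
    note ch' = fam(1,2)[OF ij(2) m'(1)] fam(3,4)[OF ij(2) m'(2)] fam(5,6)[OF ij(2) m'(3)] fam(7,8)[OF ij(2) m'(4)]
    note uX = mem_cuboid(1-4)[OF subsetD[OF X'(1) u(1)] ch(1,3,5,7)] and vX = mem_cuboid(1-4)[OF subsetD[OF X'(1) v(1)] ch(1,3,5,7)]
    note uY = mem_cuboid(1-4)[OF subsetD[OF Y'(1) u(2)] ch'(1,3,5,7)] and vY = mem_cuboid(1-4)[OF subsetD[OF Y'(1) v(2)] ch'(1,3,5,7)]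
    have le: "u \<inter> M \<subset> v \<inter> M" if "u \<inter> M \<noteq> v \<inter> M" for M using that \<open>u \<subset> v\<close> by auto
    have I: "u \<inter> I = {} \<and> v \<inter> I = I" if "u \<inter> I \<noteq> v \<inter> I"
      using orthogonal_familyD[OF F ij m(1) m'(1) uX(1) uY(1) vX(1) vY(1) le[OF that]] by blast
    have J: "u \<inter> J = {} \<and> v \<inter> J = J" if "u \<inter> J \<noteq> v \<inter> J"
      using orthogonal_familyD[OF oG ij m(2) m'(2) uX(2) uY(2) vX(2) vY(2) le[OF that]] by blast
    have K: "u \<inter> K = {} \<and> v \<inter> K = K" if "u \<inter> K \<noteq> v \<inter> K"
      using orthogonal_familyD[OF oH ij m(3) m'(3) uX(3) uY(3) vX(3) vY(3) le[OF that]] by blast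
    have L: "u \<inter> L = {} \<and> v \<inter> L = L" if "u \<inter> L \<noteq> v \<inter> L"
      using orthogonal_familyD[OF oK ij m(4) m'(4) uX(4) uY(4) vX(4) vY(4) le[OF that]] by blast
    have diff: "u \<inter> M = v \<inter> M \<or> u \<inter> M = {} \<and> v \<inter> M = M" if "M \<in> {I, J, K, L}" for M
    proof -
      from that consider "M = I" | "M = J" | "M = K" | "M = L" by auto
      then show ?thesis 
      proof cases
        case 1 then show ?thesis using I by (cases "u \<inter> I = v \<inter> I") simp_all
      next
        case 2 then show ?thesis using J by (cases "u \<inter> J = v \<inter> J") simp_all
      next
        case 3 then show ?thesis using K by (cases "u \<inter> K = v \<inter> K") simp_all
      next
        case 4 then show ?thesis using L by (cases "u \<inter> L = v \<inter> L") simp_all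
      qed
    qed
    have fI: "full I A" "full I A'" if "u \<inter> I \<noteq> v \<inter> I"
      using I[OF that] uX(1) uY(1) vX(1) vY(1) by (simp_all add: full_def)
    have fJ: "full J B" "full J B'" if "u \<inter> J \<noteq> v \<inter> J"
      using J[OF that] uX(2) uY(2) vX(2) vY(2) by (simp_all add: full_def)
    have fK: "full K C" "full K C'" if "u \<inter> K \<noteq> v \<inter> K"
      using K[OF that] uX(3) uY(3) vX(3) vY(3) by (simp_all add: full_def)
    have fL: "full L D" "full L D'" if "u \<inter> L \<noteq> v \<inter> L"
      using L[OF that] uX(4) uY(4) vX(4) vY(4) by (simp_all add: full_def)
    have big: "3 \<le> card Z" if "full M Z" "rank_chain n Z" "M \<in> {I, J, K, L}" for M Z n
      using rank_chain_full_card[OF that(2), of M] that(1,3) two by (auto simp: full_def)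
    have cJ: "3 \<le> card B \<and> 3 \<le> card B'" if "u \<inter> J \<noteq> v \<inter> J"
      using big[OF fJ(1)[OF that] ch(4)] big[OF fJ(2)[OF that] ch'(4)] by simp
    have cK: "3 \<le> card C \<and> 3 \<le> card C'" if "u \<inter> K \<noteq> v \<inter> K"
      using big[OF fK(1)[OF that] ch(6)] big[OF fK(2)[OF that] ch'(6)] by simp
    have cL: "3 \<le> card D \<and> 3 \<le> card D'" if "u \<inter> L \<noteq> v \<inter> L"
      using big[OF fL(1)[OF that] ch(8)] big[OF fL(2)[OF that] ch'(8)] by simp
    \<comment> \<open>Over a block of even size, fewer than three members means exactly one. Two
      one-element chains that share \<open>w\<close> coincide, against goodness.\<close>
    have sing: "3 \<le> card Z \<or> 3 \<le> card Z'"
      if gf: "good_family M ?S \<Z>" and Z: "Z \<in> \<Z> i" "Z' \<in> \<Z> j" "w \<in> Z" "w \<in> Z'" and ev: "even (card M)" for M \<Z> Z Z' w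
    proof (rule ccontr)
      assume small: "\<not> ?thesis"
      have o: "orthogonal_family M ?S \<Z>" using gf by (simp add: good_family_def)
      have one: "n = 1" if "1 \<le> n" "odd n" "\<not> 3 \<le> n" for n :: nat
        using that by (cases "n = 2") auto
      have "card Z = 1" "card Z' = 1"
        using rank_chain_card[OF orthogonal_family_chain(2)[OF o ij(1) Z(1)]]
          rank_chain_card[OF orthogonal_family_chain(2)[OF o ij(2) Z(2)]] ev small one by simp_all
      then have "Z = {w}" "Z' = {w}" using Z(3,4) by (auto simp: card_1_singleton_iff)
      then have "Z \<in> {C \<in> \<Z> i. card C = 1} \<inter> {C \<in> \<Z> j. card C = 1}" using Z(1,2) by simp
      moreover have "{C \<in> \<Z> i. card C = 1} \<inter> {C \<in> \<Z> j. card C = 1} = {}"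
        using gf ij by (simp add: good_family_def disjoint_family_on_def)
      ultimately show False by blast
    qed
    \<comment> \<open>A small factor on one side is thus large on the other. If \<open>J\<close>
      differs and is unflagged in the first cuboid, then \<open>D\<close> is small while
      \<open>B\<close>, \<open>B'\<close>, \<open>D'\<close> are large; so \<open>L\<close> does not
      differ, and in the second cuboid \<open>I\<close>, \<open>J\<close>, \<open>K\<close> are
      flagged whenever they differ. The cases \<open>K\<close> and \<open>L\<close>, and those with
      the cuboids exchanged, are alike by the cyclic symmetry. If both cuboids leave
      \<open>I\<close> unflagged, two factors are small in the first, hence large in the second, a
      contradiction.\<close>
    have s: "3 \<le> card B \<or> 3 \<le> card B'" "3 \<le> card C \<or> 3 \<le> card C'" "3 \<le> card D \<or> 3 \<le> card D'"
      using sing[OF G m(2) m'(2) uX(2) uY(2) even(1)] sing[OF H m(3) m'(3) uX(3) uY(3) even(2)]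
        sing[OF \<open>good_family L ?S \<K>\<close> m(4) m'(4) uX(4) uY(4) even(3)] by auto
    have "\<exists>M\<in>{I, J, K, L}. u \<inter> M \<noteq> v \<inter> M \<and> M \<notin> flags I J K L A B C D"
      by (rule unflagged_difference[OF refl X'(2) u(1) v(1) \<open>u \<subset> v\<close> neq diff])
    then have 1: "u \<inter> I \<noteq> v \<inter> I \<and> \<not> (3 \<le> card B \<and> 3 \<le> card C \<or> 3 \<le> card B \<and> 3 \<le> card D \<or> 3 \<le> card C \<and> 3 \<le> card D)
        \<or> u \<inter> J \<noteq> v \<inter> J \<and> \<not> 3 \<le> card D \<or> u \<inter> K \<noteq> v \<inter> K \<and> \<not> 3 \<le> card B \<or> u \<inter> L \<noteq> v \<inter> L \<and> \<not> 3 \<le> card C"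
      using fI(1) fJ(1) fK(1) fL(1) unfolding bex_simps mem_flags by blast
    have "\<exists>M\<in>{I, J, K, L}. u \<inter> M \<noteq> v \<inter> M \<and> M \<notin> flags I J K L A' B' C' D'"
      by (rule unflagged_difference[OF refl Y'(2) u(2) v(2) \<open>u \<subset> v\<close> neq diff])
    then have 2: "u \<inter> I \<noteq> v \<inter> I \<and> \<not> (3 \<le> card B' \<and> 3 \<le> card C' \<or> 3 \<le> card B' \<and> 3 \<le> card D' \<or> 3 \<le> card C' \<and> 3 \<le> card D')
        \<or> u \<inter> J \<noteq> v \<inter> J \<and> \<not> 3 \<le> card D' \<or> u \<inter> K \<noteq> v \<inter> K \<and> \<not> 3 \<le> card B' \<or> u \<inter> L \<noteq> v \<inter> L \<and> \<not> 3 \<le> card C'"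
      using fI(2) fJ(2) fK(2) fL(2) unfolding bex_simps mem_flags by blast
    \<comment> \<open>Purely propositional: the two cuboids cannot both leave a differing block unflagged.\<close>
    show False using 1 2 s cJ cK cL by argo
  qed
  show thesis
  proof (rule that)
    show "orthogonal_family ?U ?S \<D>"
      unfolding orthogonal_family_def
    proof (intro conjI ballI impI)
      fix i X assume "i \<in> ?S" "X \<in> \<D> i"
      then show "rank_chain (card ?U) X" using chain[of i X] by (auto simp: linkless_chain_def)
    next
      fix i j X Y u v
      assume "i \<in> ?S" "j \<in> ?S" "i \<noteq> j" "X \<in> \<D> i" "Y \<in> \<D> j" "u \<in> X \<inter> Y" "v \<in> X \<inter> Y" "u \<subset> v"
      then show "u = {}" "v = ?U" using orth[of i j X Y u v] by blast+
    qed (use part in auto)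
    show "\<exists>A\<in>\<F> i. \<exists>B\<in>\<G> i. \<exists>C\<in>\<H> i. \<exists>D\<in>\<K> i. X \<subseteq> A \<otimes> B \<otimes> C \<otimes> D" if "i \<in> ?S" "X \<in> \<D> i" for i X
      using chain[OF that] by blast
  qed
qed

end

section \<open>Transport to the hypercube\<close>

lemma good_family_image:
  assumes F: "good_family I S \<F>" and inj: "inj_on f I" and fin: "finite I"
  shows "good_family (f ` I) S (\<lambda>i. (\<lambda>X. (`) f ` X) ` \<F> i)"
proof -
  have o: "orthogonal_family I S \<F>" using F by (simp add: good_family_def)
  have injP: "inj_on ((`) f) (Pow I)" using inj by (rule inj_on_image_Pow)
  have "disjoint_family_on (\<lambda>i. {C \<in> (\<lambda>X. (`) f ` X) ` \<F> i. card C = 1}) S"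
    unfolding disjoint_family_on_def
  proof (intro ballI impI, rule ccontr)
    fix i j assume ij: "i \<in> S" "j \<in> S" "i \<noteq> j"
      and "{C \<in> (\<lambda>X. (`) f ` X) ` \<F> i. card C = 1} \<inter> {C \<in> (\<lambda>X. (`) f ` X) ` \<F> j. card C = 1} \<noteq> {}"
    then obtain A B where AB: "A \<in> \<F> i" "B \<in> \<F> j" "(`) f ` A = (`) f ` B" "card ((`) f ` A) = 1"
      by blast
    have sub: "A \<subseteq> Pow I" "B \<subseteq> Pow I"
      using orthogonal_family_chain(1)[OF o ij(1) AB(1)] orthogonal_family_chain(1)[OF o ij(2) AB(2)] .
    have "A = B" using inj_on_image_eq_iff[OF injP sub] AB(3) by simp
    moreover have "card A = 1" using card_image[OF inj_on_subset[OF injP sub(1)]] AB(4) by simp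
    moreover have "{C \<in> \<F> i. card C = 1} \<inter> {C \<in> \<F> j. card C = 1} = {}"
      using F ij by (simp add: good_family_def disjoint_family_on_def)
    ultimately show False using AB(1,2) by blast
  qed
  then show ?thesis unfolding good_family_def using orthogonal_family_image[OF o inj fin] by simp
qed

text \<open>The nested pairings shift the factors by accumulated offsets, which are the translations
  that place the four blocks side by side.\<close>

lemma cuboid_eq_join:
  "cuboid m n p A B C D =
    A \<otimes> (`) ((+) m) ` B \<otimes> (`) ((+) (m + n)) ` C \<otimes> (`) ((+) (m + n + p)) ` D"
proof -
  have "cube_pair m a (cube_pair n b (cube_pair p c d)) =
      a \<union> (+) m ` b \<union> (+) (m + n) ` c \<union> (+) (m + n + p) ` d" for a b c d
    unfolding cube_pair_def image_Un image_image by (simp add: add.assoc Un_assoc)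
  then show ?thesis unfolding cuboid_def join_def by auto
qed

theorem theorem9p1:
  fixes m n p q k :: nat
    and \<F> \<G> \<H> \<K> :: "nat \<Rightarrow> nat set set set"
  assumes "odd m" "m \<ge> 3"
    and "even n" "n \<ge> 2"
    and "even p" "p \<ge> 2"
    and "even q" "q \<ge> 2"
    and "k \<ge> 3"
    and "almost_orthogonal_scds m {1..k} \<F>"
    and "good_scds n {1..k} \<G>"
    and "good_scds p {1..k} \<H>"
    and "good_scds q {1..k} \<K>"
  shows "\<exists>\<D> :: nat \<Rightarrow> nat set set set.
           almost_orthogonal_scds (m + n + p + q) {1..k} \<D> \<and>
           (\<forall>i\<in>{1..k}. \<forall>X\<in>\<D> i.
              \<exists>A\<in>\<F> i. \<exists>B\<in>\<G> i. \<exists>C\<in>\<H> i. \<exists>D\<in>\<K> i. X \<subseteq> cuboid m n p A B C D)"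
proof -
  define J where "J = (+) m ` {1..n}"
  define K where "K = (+) (m + n) ` {1..p}"
  define L where "L = (+) (m + n + p) ` {1..q}"
  define \<G>' where "\<G>' = (\<lambda>i. (\<lambda>X. (`) ((+) m) ` X) ` \<G> i)"
  define \<H>' where "\<H>' = (\<lambda>i. (\<lambda>X. (`) ((+) (m + n)) ` X) ` \<H> i)"
  define \<K>' where "\<K>' = (\<lambda>i. (\<lambda>X. (`) ((+) (m + n + p)) ` X) ` \<K> i)"
  have card: "card J = n" "card K = p" "card L = q"
    unfolding J_def K_def L_def by (simp_all add: card_image)
  have intervals: "J = {m + 1..m + n}" "K = {m + n + 1..m + n + p}" "L = {m + n + p + 1..m + n + p + q}"
    unfolding J_def K_def L_def by simp_all
  have U: "{1..m} \<union> J \<union> K \<union> L = {1..m + n + p + q}"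
    unfolding intervals by auto
  interpret four_blocks "{1..m}" J K L
    by unfold_locales (use assms(2,4,6,8) card in \<open>auto simp: intervals\<close>)
  have good: "good_family {1..r} {1..k} \<Z>" if "good_scds r {1..k} \<Z>" "2 \<le> r" for r \<Z>
    using that orthogonal_family_iff[of r "{1..k}" \<Z>] by (simp add: good_scds_def good_family_def)
  have F: "orthogonal_family {1..m} {1..k} \<F>" using assms(2,10) by (simp add: orthogonal_family_iff)
  have G: "good_family J {1..k} \<G>'" unfolding J_def \<G>'_def
    by (rule good_family_image[OF good[OF assms(11,4)]]) auto
  have H: "good_family K {1..k} \<H>'" unfolding K_def \<H>'_def
    by (rule good_family_image[OF good[OF assms(12,6)]]) auto
  have K: "good_family L {1..k} \<K>'" unfolding L_def \<K>'_def
    by (rule good_family_image[OF good[OF assms(13,8)]]) auto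
  have par: "odd (card {1..m})" "even (card J)" "even (card K)" "even (card L)"
    using assms(1,3,5,7) card by simp_all
  obtain \<D> where D: "orthogonal_family ({1..m} \<union> J \<union> K \<union> L) {1..k} \<D>"
    "\<And>i X. i \<in> {1..k} \<Longrightarrow> X \<in> \<D> i \<Longrightarrow> \<exists>A\<in>\<F> i. \<exists>B\<in>\<G>' i. \<exists>C\<in>\<H>' i. \<exists>D\<in>\<K>' i. X \<subseteq> A \<otimes> B \<otimes> C \<otimes> D"
    using product_family[OF par assms(9) F G H K] by blast
  have "almost_orthogonal_scds (m + n + p + q) {1..k} \<D>"
    using D(1) assms(2) unfolding U by (subst orthogonal_family_iff) auto
  moreover have "\<exists>A\<in>\<F> i. \<exists>B\<in>\<G> i. \<exists>C\<in>\<H> i. \<exists>D\<in>\<K> i. X \<subseteq> cuboid m n p A B C D"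
    if "i \<in> {1..k}" "X \<in> \<D> i" for i X
    using D(2)[OF that] unfolding \<G>'_def \<H>'_def \<K>'_def cuboid_eq_join by (simp only: bex_simps)
  ultimately show ?thesis by blast
qed

end
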